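(* Let $\lambda:[0,\infty)\to[0,\infty)$ be an intensity function and let $\Lambda(t)=\int_0^t \lambda(u)\,du$ for $t\ge 0$. Suppose that $\Lambda$ satisfies the following conditions: (i) $\lim_{x\to\infty}\Lambda(x)=\infty$; (ii) there exists a constant $c>0$ such that, as $x\to\infty$, $$\frac{\Lambda'(x)}{\Lambda(x)}=\frac{c}{x}+\mathcal{O}\left(\frac{1}{x\log x}\right).$$ Let $0<\beta<1$, and let $$P_\beta(n,t)=\int_0^\infty \frac{e^{-\Lambda(u)}\Lambda(u)^n}{n!}\,h_\beta(t,u)\,du$$ be the marginal probabilities of the fractional non-homogeneous Poisson process. Then for every $z_0>0$, $$\lim_{\substack{n\to\infty\\ n=\Lambda(z_0t^\beta)}} n\,P_\beta(n,t)=\frac{z_0}{c}\,M_\beta(z_0),$$ where the limit is taken as the positive integer $n$ tends to infinity, with $t>0$ related to $n$ by the equation $n=\Lambda(z_0t^\beta)$.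
   Context: For $0<\beta<1$ and $t,x>0$, $h_\beta$ is the density (in $x$) of the inverse $\beta$-stable subordinator: $$h_\beta(t,x)=\frac{t}{\beta x^{1+1/\beta}}\,g_\beta\left(\frac{t}{x^{1/\beta}}\right),\qquad g_\beta(u)=\frac1\pi\sum_{j=1}^\infty(-1)^{j+1}\frac{\Gamma(\beta j+1)}{\Gamma(j+1)}\frac{1}{u^{\beta j+1}}\sin(\beta\pi j)\quad(u>0).$$ The M-Wright function (Mainardi function) is $$M_\beta(z)=\frac1\pi\sum_{j=1}^\infty\frac{(-z)^{j-1}}{(j-1)!}\,\Gamma(\beta j)\,\sin(\pi\beta j).$$ The intensity $\lambda$ is such that $\Lambda(t)=\int_0^t\lambda(u)\,du$ is finite for every $t\ge 0$. $\Lambda'$ denotes the derivative of $\Lambda$; condition (ii) is understood to include its existence for all sufficiently large $x$. *)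

theory Defs
  imports "HOL-Analysis.Analysis" "HOL-Library.Landau_Symbols"
begin

text \<open>The stable densities and the M-Wright function are meant for \<open>0 < \<beta> < 1\<close>, where the defining
  series converge absolutely (for \<open>u > 0\<close> in the case of \<open>stable_density\<close>). Series over \<open>j \<ge> 1\<close> are indexed by \<open>j = Suc k\<close>.\<close>

text \<open>Density of the standard \<open>\<beta>\<close>-stable subordinator at time 1 (for \<open>u > 0\<close>).\<close>

definition stable_density :: "real \<Rightarrow> real \<Rightarrow> real" where
  "stable_density \<beta> u =
     1 / pi * (\<Sum>k. (-1) ^ (Suc k + 1) * (Gamma (\<beta> * real (Suc k) + 1) / Gamma (real (Suc k) + 1))
                   * (1 / u powr (\<beta> * real (Suc k) + 1)) * sin (\<beta> * pi * real (Suc k)))"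

text \<open>Density in \<open>x > 0\<close> of the inverse \<open>\<beta>\<close>-stable subordinator at time \<open>t > 0\<close>.\<close>

definition inverse_stable_density :: "real \<Rightarrow> real \<Rightarrow> real \<Rightarrow> real" where
  "inverse_stable_density \<beta> t x =
     t / (\<beta> * x powr (1 + 1 / \<beta>)) * stable_density \<beta> (t / x powr (1 / \<beta>))"

definition M_Wright :: "real \<Rightarrow> real \<Rightarrow> real" where
  "M_Wright \<beta> z =
     1 / pi * (\<Sum>k. (- z) ^ (Suc k - 1) / fact (Suc k - 1)
                   * Gamma (\<beta> * real (Suc k)) * sin (pi * \<beta> * real (Suc k)))"

text \<open>Marginal probabilities of the fractional non-homogeneous Poisson process with
  cumulative intensity \<open>\<Lambda>\<close>.\<close>

definition fnpp_prob :: "(real \<Rightarrow> real) \<Rightarrow> real \<Rightarrow> nat \<Rightarrow> real \<Rightarrow> real" where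
  "fnpp_prob \<Lambda> \<beta> n t =
     (LINT u:{0<..}|lebesgue. exp (- \<Lambda> u) * \<Lambda> u ^ n / fact n * inverse_stable_density \<beta> t u)"

text \<open>The filter ``\<open>n \<longrightarrow> \<infinity>\<close> along the pairs \<open>(n, t)\<close> with \<open>t > 0\<close> and \<open>n = \<Lambda> (z\<^sub>0 t\<^sup>\<beta>)\<close>''. Convergence along
  it is uniform over all such \<open>t\<close>, so it covers every choice of \<open>t\<close> as a function of \<open>n\<close>. The
  filter is proper if \<open>\<Lambda>\<close> is continuous on \<open>[0, \<infinity>)\<close>, \<open>\<Lambda> 0 = 0\<close>, \<open>\<Lambda>\<close> is unbounded, \<open>\<beta> > 0\<close> and
  \<open>z\<^sub>0 > 0\<close>.\<close>

definition along_level :: "(real \<Rightarrow> real) \<Rightarrow> real \<Rightarrow> real \<Rightarrow> (nat \<times> real) filter" where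
  "along_level \<Lambda> \<beta> z\<^sub>0 =
     inf (filtercomap fst at_top) (principal {(n, t). t > 0 \<and> real n = \<Lambda> (z\<^sub>0 * t powr \<beta>)})"

end

theory Submission imports Defs begin

text \<open>The density of the inverse stable subordinator is a scaling family: \<open>h\<^sub>\<beta>(t, u) = t powr (- \<beta>) * M\<^sub>\<beta>(u t powr (- \<beta>))\<close>
  (\<open>inverse_stable_density_eq_M_Wright\<close>). With \<open>x = z\<^sub>0 t\<^sup>\<beta>\<close>, so that \<open>n = \<Lambda> x\<close>, and \<open>\<psi> v = z\<^sub>0 M\<^sub>\<beta>(z\<^sub>0 v)\<close>,
  the quantity \<open>n P\<^sub>\<beta>(n, t)\<close> is the integral over \<open>u > 0\<close> of the Poisson weight
  \<open>n exp (- \<Lambda> u) \<Lambda>(u)\<^sup>n / fact n\<close> against \<open>\<psi>(u / x) / x\<close>. The weight is concentrated where \<open>\<Lambda> u\<close> is close to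
  \<open>n = \<Lambda> x\<close>. As \<open>u \<Lambda>'(u) / \<Lambda>(u)\<close> tends to \<open>c\<close>, the function \<open>\<Lambda>\<close> grows at least like a positive power of \<open>u\<close>,
  and so the weight is concentrated near \<open>u = x\<close>.

  The mass of this concentrated kernel comes from an exact derivative. The Poisson tail
  \<open>y \<mapsto> P(Poisson(y) \<ge> n)\<close> has derivative \<open>exp (- y) y ^ (n - 1) / fact (n - 1)\<close>, hence the weight times
  \<open>(u \<Lambda>'(u) / \<Lambda>(u)) / u\<close> is the derivative, in \<open>u\<close>, of the tail at \<open>y = \<Lambda> u\<close>. Its integral over a neighbourhood of
  \<open>x\<close> tends to 1, and on that neighbourhood the remaining factor \<open>(u / x) \<psi>(u / x) / (u \<Lambda>'(u) / \<Lambda>(u))\<close> is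
  close to \<open>\<psi>(1) / c = z\<^sub>0 M\<^sub>\<beta>(z\<^sub>0) / c\<close>. Chernoff bounds for the Poisson law handle the rest of the half-line.
  This is \<open>poisson_kernel_concentration\<close>.

  The argument needs \<open>z M\<^sub>\<beta>(z)\<close> to be bounded on the half-line (\<open>abs_mult_M_Wright_le\<close>), which the
  power series does not show. The bound comes from an integral representation
  along a rotated ray, on which the factor depending on \<open>z\<close> decays for every \<open>\<beta>\<close> in \<open>(0, 1)\<close>.\<close>

section \<open>Poisson weights as functions of the mean\<close>

definition poisson :: "nat \<Rightarrow> real \<Rightarrow> real" where
  "poisson n y = exp (- y) * y ^ n / fact n"

text \<open>The probability that a Poisson variable with mean \<open>y\<close> is at least \<open>n\<close>.\<close>

definition poisson_tail :: "nat \<Rightarrow> real \<Rightarrow> real" where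
  "poisson_tail n y = 1 - (\<Sum>k<n. poisson k y)"

text \<open>For a Poisson law with mean \<open>r n\<close>, the \<open>n\<close>-th power of this number is the optimal Chernoff bound on the weight
  at \<open>n\<close> and on the tail that starts at \<open>n\<close> and points away from the mean.\<close>

definition chernoff_rate :: "real \<Rightarrow> real" where
  "chernoff_rate r = r * exp (1 - r)"

lemma poisson_nonneg: "y \<ge> 0 \<Longrightarrow> poisson n y \<ge> 0"
  by (simp add: poisson_def)

lemma Suc_mult_poisson: "real (Suc n) * poisson (Suc n) y = y * poisson n y"
  by (simp add: poisson_def field_simps del: of_nat_Suc)

lemma poisson_generating_function: "(\<lambda>k. poisson k y * q ^ k) sums exp (y * (q - 1))"
proof -
  have "(\<lambda>k. exp (- y) * ((y * q) ^ k /\<^sub>R fact k)) sums (exp (- y) * exp (y * q))"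
    by (intro sums_mult exp_converges)
  then show ?thesis
    by (simp add: poisson_def power_mult_distrib scaleR_conv_of_real divide_inverse algebra_simps
        flip: exp_add)
qed

lemma poisson_tail_sums: "(\<lambda>k. poisson (k + n) y) sums poisson_tail n y"
  using poisson_generating_function[of y 1] sums_iff_shift[of "\<lambda>k. poisson k y" n "poisson_tail n y"]
  by (simp add: poisson_tail_def)

lemma poisson_tail_bounds:
  assumes "y \<ge> 0"
  shows "poisson_tail n y \<ge> 0" "poisson_tail n y \<le> 1"
proof -
  show "poisson_tail n y \<ge> 0"
    using sums_le[OF _ sums_zero poisson_tail_sums] poisson_nonneg[OF assms] by blast
  show "poisson_tail n y \<le> 1"
    using poisson_nonneg[OF assms] by (simp add: poisson_tail_def sum_nonneg)
qed

text \<open>The derivatives of the weights telescope. Thus the Poisson weights, read as functions of the mean,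
  are the Gamma densities, and the tail is their distribution function.\<close>

lemma poisson_tail_has_derivative:
  "(poisson_tail (Suc n) has_real_derivative poisson n y) (at y within S)"
proof (induction n)
  case 0
  have "poisson_tail (Suc 0) = (\<lambda>y. 1 - exp (- y))"
    by (simp add: poisson_tail_def poisson_def fun_eq_iff)
  then show ?case
    by (auto simp: poisson_def intro!: derivative_eq_intros)
next
  case (Suc n)
  have eq: "poisson_tail (Suc (Suc n)) = (\<lambda>y. poisson_tail (Suc n) y - poisson (Suc n) y)"
    by (simp add: poisson_tail_def fun_eq_iff)
  have "(poisson (Suc n) has_real_derivative poisson n y - poisson (Suc n) y) (at y within S)"
  proof -
    have "((\<lambda>y. exp (- y) * (y ^ Suc n / fact (Suc n))) has_real_derivative
        exp (- y) * (real (Suc n) * y ^ n / fact (Suc n)) - exp (- y) * (y ^ Suc n / fact (Suc n)))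
        (at y within S)"
    proof -
      have "((\<lambda>y. y ^ Suc n) has_real_derivative real (Suc n) * y ^ n) (at y within S)"
        using DERIV_pow[of "Suc n" y S] by simp
      then show ?thesis
        by (auto intro!: derivative_eq_intros simp: diff_divide_distrib mult_ac simp del: power_Suc of_nat_Suc fact_Suc)
    qed
    moreover have "real (Suc n) * y ^ n / fact (Suc n) = y ^ n / fact n"
      by (simp del: of_nat_Suc)
    moreover have "poisson (Suc n) = (\<lambda>y. exp (- y) * (y ^ Suc n / fact (Suc n)))"
      by (intro ext) (simp only: poisson_def times_divide_eq_right)
    ultimately show ?thesis
      by (simp only: poisson_def times_divide_eq_right)
  qed
  then show ?case
    unfolding eq by (auto intro!: derivative_eq_intros Suc.IH)
qed

text \<open>Chernoff's method: compare each weight with its multiple by the power of \<open>q\<close> in the generating function.\<close>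

lemma
  fixes y q :: real
  assumes y: "y \<ge> 0" and q: "q > 0"
  shows poisson_le: "poisson n y \<le> exp (y * (q - 1)) / q ^ n"
    and poisson_tail_le: "q \<ge> 1 \<Longrightarrow> poisson_tail n y \<le> exp (y * (q - 1)) / q ^ n"
    and one_minus_poisson_tail_le: "q \<le> 1 \<Longrightarrow> 1 - poisson_tail n y \<le> exp (y * (q - 1)) / q ^ n"
proof -
  note gf = poisson_generating_function[of y q]
  have nonneg: "poisson k y * q ^ k \<ge> 0" for k
    using poisson_nonneg[OF y] q by simp
  have "(\<Sum>k\<in>{n}. poisson k y * q ^ k) \<le> exp (y * (q - 1))"
    using nonneg gf by (intro sum_le_suminf[of _ "{n}", THEN order_trans]) (auto simp: sums_iff)
  then show "poisson n y \<le> exp (y * (q - 1)) / q ^ n"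
    using q by (simp add: field_simps)
  have split: "(\<lambda>k. poisson (k + n) y * q ^ (k + n)) sums
      (exp (y * (q - 1)) - (\<Sum>k<n. poisson k y * q ^ k))"
    using gf sums_iff_shift[of "\<lambda>k. poisson k y * q ^ k" n] by simp
  show "poisson_tail n y \<le> exp (y * (q - 1)) / q ^ n" if "q \<ge> 1"
  proof -
    have "poisson_tail n y * q ^ n \<le> exp (y * (q - 1)) - (\<Sum>k<n. poisson k y * q ^ k)"
    proof (rule sums_le[OF _ sums_mult2[OF poisson_tail_sums] split])
      fix k show "poisson (k + n) y * q ^ n \<le> poisson (k + n) y * q ^ (k + n)"
        using that poisson_nonneg[OF y] by (intro mult_left_mono power_increasing) auto
    qed
    also have "\<dots> \<le> exp (y * (q - 1))"
      using nonneg by (simp add: sum_nonneg)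
    finally show ?thesis using q by (simp add: field_simps)
  qed
  show "1 - poisson_tail n y \<le> exp (y * (q - 1)) / q ^ n" if "q \<le> 1"
  proof -
    have "(1 - poisson_tail n y) * q ^ n = (\<Sum>k<n. poisson k y * q ^ n)"
      by (simp add: poisson_tail_def sum_distrib_right)
    also have "\<dots> \<le> (\<Sum>k<n. poisson k y * q ^ k)"
      using that q poisson_nonneg[OF y] by (intro sum_mono mult_left_mono power_decreasing) auto
    also have "\<dots> \<le> exp (y * (q - 1))"
      using nonneg gf by (intro sum_le_suminf[of _ "{..<n}", THEN order_trans]) (auto simp: sums_iff)
    finally show ?thesis using q by (simp add: field_simps)
  qed
qed

text \<open>The choice \<open>q = 1 / r\<close> minimises the preceding bound at \<open>y = r n\<close>. The exponent is monotone in \<open>y\<close>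
  in the direction that matters, so the bound persists for means farther away from \<open>n\<close>.\<close>

lemma
  fixes y r :: real
  assumes y: "y \<ge> 0" and r: "r > 0"
  shows poisson_le_below: "r \<le> 1 \<Longrightarrow> y \<le> r * real n \<Longrightarrow> poisson n y \<le> chernoff_rate r ^ n"
    and poisson_tail_le_below: "r \<le> 1 \<Longrightarrow> y \<le> r * real n \<Longrightarrow> poisson_tail n y \<le> chernoff_rate r ^ n"
    and one_minus_poisson_tail_le_above:
      "r \<ge> 1 \<Longrightarrow> y \<ge> r * real n \<Longrightarrow> 1 - poisson_tail n y \<le> chernoff_rate r ^ n"
proof -
  have "y * (1 / r - 1) \<le> r * real n * (1 / r - 1)"
    if "(r \<le> 1 \<and> y \<le> r * real n) \<or> (r \<ge> 1 \<and> y \<ge> r * real n)"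
    using that
  proof
    assume "r \<le> 1 \<and> y \<le> r * real n"
    moreover from this have "1 / r - 1 \<ge> 0" using r by simp
    ultimately show ?thesis by (intro mult_right_mono) auto
  next
    assume "r \<ge> 1 \<and> y \<ge> r * real n"
    moreover from this have "1 / r - 1 \<le> 0" using r by simp
    ultimately show ?thesis by (intro mult_right_mono_neg) auto
  qed
  then have bound: "exp (y * (1 / r - 1)) / (1 / r) ^ n \<le> chernoff_rate r ^ n"
    if "(r \<le> 1 \<and> y \<le> r * real n) \<or> (r \<ge> 1 \<and> y \<ge> r * real n)"
  proof -
    have "exp (y * (1 / r - 1)) / (1 / r) ^ n \<le> exp (r * real n * (1 / r - 1)) / (1 / r) ^ n"
      using that \<open>_ \<Longrightarrow> y * (1 / r - 1) \<le> _\<close> r by (intro divide_right_mono) auto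
    also have "r * real n * (1 / r - 1) = real n * (1 - r)" using r by (simp add: field_simps)
    also have "exp (real n * (1 - r)) / (1 / r) ^ n = chernoff_rate r ^ n"
      using r by (simp add: chernoff_rate_def power_mult_distrib power_divide exp_of_nat_mult)
    finally show ?thesis .
  qed
  show "poisson n y \<le> chernoff_rate r ^ n" if "r \<le> 1" "y \<le> r * real n"
    using poisson_le[OF y, of "1 / r" n] bound that r by auto
  show "poisson_tail n y \<le> chernoff_rate r ^ n" if "r \<le> 1" "y \<le> r * real n"
    using poisson_tail_le[OF y, of "1 / r" n] bound that r by auto
  show "1 - poisson_tail n y \<le> chernoff_rate r ^ n" if "r \<ge> 1" "y \<ge> r * real n"
    using one_minus_poisson_tail_le[OF y, of "1 / r" n] bound that r by auto
qed

lemma chernoff_rate_less_1: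
  assumes "r > 0" "r \<noteq> 1"
  shows "0 < chernoff_rate r" "chernoff_rate r < 1"
proof -
  show "0 < chernoff_rate r" using assms by (simp add: chernoff_rate_def)
  have "ln r < r - 1"
    using ln_le_minus_one[of r] ln_eq_minus_one[of r] assms by force
  then have "exp (ln r) < exp (r - 1)" by (subst exp_less_cancel_iff)
  then have "r < exp (r - 1)" using assms by simp
  then have "r * exp (1 - r) < exp (r - 1) * exp (1 - r)"
    by (intro mult_strict_right_mono) auto
  then show "chernoff_rate r < 1"
    by (simp add: chernoff_rate_def flip: exp_add)
qed

lemma poisson_tail_tendsto_1: "(poisson_tail n \<longlongrightarrow> 1) at_top"
proof (rule tendsto_sandwich)
  have "1 - exp (- (y / 2)) * 2 ^ n \<le> poisson_tail n y" if "y \<ge> 0" for y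
    using one_minus_poisson_tail_le[OF that, of "1 / 2" n] by (simp add: power_divide algebra_simps)
  then show "\<forall>\<^sub>F y in at_top. 1 - exp (- (y / 2)) * 2 ^ n \<le> poisson_tail n y"
    by (rule eventually_mono[OF eventually_ge_at_top[of 0]])
  show "\<forall>\<^sub>F y in at_top. poisson_tail n y \<le> 1"
    using eventually_ge_at_top[of 0] by eventually_elim (rule poisson_tail_bounds)
  have "filterlim (\<lambda>y::real. 1 / 2 * y) at_top at_top"
    by (intro filterlim_tendsto_pos_mult_at_top[OF tendsto_const] filterlim_ident) auto
  then have "((\<lambda>y::real. 1 - exp (- (1 / 2 * y)) * 2 ^ n) \<longlongrightarrow> 1 - 0 * 2 ^ n) at_top"
    by (intro tendsto_intros filterlim_compose[OF exp_at_bot] filterlim_uminus_at_top[THEN iffD1])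
  then show "((\<lambda>y::real. 1 - exp (- (y / 2)) * 2 ^ n) \<longlongrightarrow> 1) at_top" by simp
qed simp

section \<open>Functions with a logarithmic derivative of order 1/u\<close>

text \<open>The hypothesis says that \<open>ln (\<Lambda> u) - a ln u\<close> has a nonnegative derivative. Monotonicity from
  a pointwise derivative avoids integrating \<open>\<Lambda>' / \<Lambda>\<close>.\<close>

lemma growth_of_log_derivative_ge:
  fixes \<Lambda> \<Lambda>' :: "real \<Rightarrow> real"
  assumes X: "X > 0"
    and pos: "\<And>u. u \<ge> X \<Longrightarrow> \<Lambda> u > 0"
    and deriv: "\<And>u. u \<ge> X \<Longrightarrow> (\<Lambda> has_real_derivative \<Lambda>' u) (at u)"
    and ratio: "\<And>u. u \<ge> X \<Longrightarrow> u * \<Lambda>' u / \<Lambda> u \<ge> a"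
    and xy: "X \<le> x" "x \<le> y"
  shows "\<Lambda> x * (y / x) powr a \<le> \<Lambda> y"
proof -
  have "ln (\<Lambda> x) - a * ln x \<le> ln (\<Lambda> y) - a * ln y"
  proof (rule DERIV_nonneg_imp_nondecreasing[OF xy(2)])
    fix u assume u: "x \<le> u"
    then have "((\<lambda>u. ln (\<Lambda> u) - a * ln u) has_real_derivative (\<Lambda>' u / \<Lambda> u - a * (1 / u))) (at u)"
      using X xy pos[of u] deriv[of u] by (auto intro!: derivative_eq_intros)
    moreover have "\<Lambda>' u / \<Lambda> u - a * (1 / u) \<ge> 0"
      using ratio[of u] X xy u pos[of u] by (simp add: field_simps)
    ultimately show "\<exists>d. ((\<lambda>u. ln (\<Lambda> u) - a * ln u) has_real_derivative d) (at u) \<and> d \<ge> 0" by blast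
  qed
  then have "exp (ln (\<Lambda> x) + a * ln (y / x)) \<le> exp (ln (\<Lambda> y))"
    using X xy by (subst exp_le_cancel_iff) (simp add: ln_div algebra_simps)
  then show ?thesis
    using X xy pos[of x] pos[of y] by (simp add: exp_add powr_def)
qed

text \<open>The derivative is a limit of difference quotients along a sequence; the indicator restricts it to
  the half-line on which it is known to exist.\<close>

lemma borel_measurable_real_derivative:
  fixes f f' :: "real \<Rightarrow> real"
  assumes f[measurable]: "f \<in> borel_measurable borel"
    and deriv: "\<And>u. u \<ge> X \<Longrightarrow> (f has_real_derivative f' u) (at u)"
  shows "(\<lambda>u. indicator {X..} u * f' u) \<in> borel_measurable borel"
proof (rule borel_measurable_LIMSEQ_real)
  fix u :: real
  have "(\<lambda>k. (f (u + 1 / real (Suc k)) - f u) / (1 / real (Suc k))) \<longlonglongrightarrow> f' u" if "u \<ge> X"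
  proof (rule filterlim_compose[OF deriv[OF that, unfolded DERIV_def]])
    show "filterlim (\<lambda>k. 1 / real (Suc k)) (at 0) sequentially"
      using LIMSEQ_inverse_real_of_nat
      by (auto simp: filterlim_at divide_inverse simp del: of_nat_Suc)
  qed
  then show "(\<lambda>k. indicator {X..} u * ((f (u + 1 / real (Suc k)) - f u) / (1 / real (Suc k))))
      \<longlonglongrightarrow> indicator {X..} u * f' u"
    by (auto simp: indicator_def simp del: of_nat_Suc)
qed measurable


section \<open>Concentration of the Poisson kernel\<close>

text \<open>Write \<open>D u = u \<Lambda>' u / \<Lambda> u\<close>. Where \<open>\<Lambda>\<close> is differentiable, the chain rule gives
  \<open>(d/du) poisson_tail n (\<Lambda> u) = poisson (n - 1) (\<Lambda> u) * \<Lambda>' u = n * poisson n (\<Lambda> u) * D u / u\<close>.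
  Call this function \<open>\<rho>\<close>. On \<open>[x / 2, \<infinity>)\<close> the integrand therefore equals \<open>\<rho> u * (v * \<psi> v / D u)\<close> with
  \<open>v = u / x\<close>. Here \<open>\<rho>\<close> has total mass at most 1, and its antiderivative is explicit, so the
  Poisson tail bounds show directly that its mass outside \<open>[x (1 - \<delta>), x (1 + \<delta>)]\<close> tends to 0; the
  growth of \<open>\<Lambda>\<close> keeps \<open>\<Lambda> u / n\<close> away from 1 there. The other factor is bounded and close to \<open>\<psi> 1 / c\<close> near
  \<open>u = x\<close>. Boundedness of \<open>v * \<psi> v\<close>, rather than integrability of \<open>\<psi>\<close>, is what controls the integral
  at infinity. On \<open>(0, x / 2)\<close> the weight itself is exponentially small.\<close>

theorem poisson_kernel_concentration:
  fixes \<Lambda> \<Lambda>' \<psi> :: "real \<Rightarrow> real" and c B :: real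
  assumes mono: "mono \<Lambda>"
    and nonneg: "\<And>u. \<Lambda> u \<ge> 0"
    and at_top: "filterlim \<Lambda> at_top at_top"
    and deriv: "\<forall>\<^sub>F u in at_top. (\<Lambda> has_real_derivative \<Lambda>' u) (at u)"
    and ratio: "((\<lambda>u. u * \<Lambda>' u / \<Lambda> u) \<longlongrightarrow> c) at_top" and c: "c > 0"
    and \<psi>[measurable]: "\<psi> \<in> borel_measurable borel"
    and \<psi>_near: "\<And>v. 0 < v \<Longrightarrow> v \<le> 1 \<Longrightarrow> \<bar>\<psi> v\<bar> \<le> B"
    and \<psi>_far: "\<And>v. v > 0 \<Longrightarrow> \<bar>v * \<psi> v\<bar> \<le> B"
    and \<psi>_cont: "isCont \<psi> 1"
  shows "((\<lambda>(n, x). \<integral>u. indicator {0<..} u * (real n * poisson n (\<Lambda> u) * (\<psi> (u / x) / x)) \<partial>lborel)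
           \<longlongrightarrow> \<psi> 1 / c) (inf (filtercomap fst at_top) (principal {(n, x). x > 0 \<and> real n = \<Lambda> x}))"
proof (rule tendstoI)
  fix \<epsilon> :: real assume \<epsilon>: "\<epsilon> > 0"
  have [measurable]: "\<Lambda> \<in> borel_measurable borel" by (rule borel_measurable_mono[OF mono])
  define D where "D u = u * \<Lambda>' u / \<Lambda> u" for u
  define K where "K = \<psi> 1 / c"
  define \<eta> where "\<eta> = \<epsilon> / 6"
  have \<eta>: "\<eta> > 0" using \<epsilon> by (simp add: \<eta>_def)

  have "B \<ge> 0" using \<psi>_far[of 1] by linarith

  \<comment> \<open>Joint continuity at \<open>v = 1\<close>, \<open>u = \<infinity>\<close> gives the window on which the second factor is within \<open>\<eta>\<close> of its limit.\<close>
  have "((\<lambda>p. fst p * \<psi> (fst p) / D (snd p)) \<longlongrightarrow> 1 * \<psi> 1 / c) (nhds 1 \<times>\<^sub>F at_top)"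
    using ratio c \<psi>_cont unfolding D_def[abs_def, symmetric]
    by (intro tendsto_intros filterlim_compose[OF _ filterlim_fst] filterlim_compose[OF _ filterlim_snd])
       (auto simp: isCont_def tendsto_at_iff_tendsto_nhds D_def[abs_def] intro: filterlim_ident)
  then have "\<forall>\<^sub>F p in nhds 1 \<times>\<^sub>F at_top. dist (fst p * \<psi> (fst p) / D (snd p)) K < \<eta>"
    using \<eta> by (simp add: tendsto_iff K_def)
  then obtain P Q where P: "eventually P (nhds 1)" and Q: "eventually Q at_top"
    and PQ: "\<And>v u. P v \<Longrightarrow> Q u \<Longrightarrow> \<bar>v * \<psi> v / D u - K\<bar> < \<eta>"
    by (auto simp: eventually_prod_filter dist_real_def)
  obtain d where d: "d > 0" "\<And>v. \<bar>v - 1\<bar> < d \<Longrightarrow> P v"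
    using P by (auto simp: eventually_nhds_metric dist_real_def)
  \<comment> \<open>Half of \<open>d\<close>, so that the window is closed and its complement is covered by half-lines that omit their end points.\<close>
  define \<delta> where "\<delta> = min (d / 2) (1 / 4)"
  have \<delta>: "0 < \<delta>" "\<delta> < 1 / 2" "\<And>v. \<bar>v - 1\<bar> \<le> \<delta> \<Longrightarrow> P v"
    using d by (auto simp: \<delta>_def)

  have "\<forall>\<^sub>F u in at_top. u > 0 \<and> \<Lambda> u > 0 \<and> D u > c / 2 \<and> Q u
      \<and> (\<Lambda> has_real_derivative \<Lambda>' u) (at u)"
  proof (intro eventually_conj eventually_gt_at_top deriv Q)
    show "\<forall>\<^sub>F u in at_top. \<Lambda> u > 0"
      using at_top by (simp add: filterlim_at_top_dense)
    show "\<forall>\<^sub>F u in at_top. D u > c / 2"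
      using ratio c unfolding D_def by (intro order_tendstoD(1)[where y = c]) auto
  qed
  then obtain X where X: "\<And>u. u \<ge> X \<Longrightarrow> u > 0 \<and> \<Lambda> u > 0 \<and> D u > c / 2 \<and> Q u
      \<and> (\<Lambda> has_real_derivative \<Lambda>' u) (at u)"
    by (auto simp: eventually_at_top_linorder)
  have "X > 0" using X by blast
  have growth: "\<Lambda> x * (y / x) powr (c / 2) \<le> \<Lambda> y" if "X \<le> x" "x \<le> y" for x y
    using \<open>X > 0\<close> that X by (intro growth_of_log_derivative_ge[of X \<Lambda> \<Lambda>']) (auto simp: D_def less_imp_le)

  \<comment> \<open>By the growth estimate, these numbers separate \<open>\<Lambda> u / n\<close> from 1 on \<open>u \<le> x / 2\<close>, \<open>u \<le> x (1 - \<delta>)\<close> and \<open>u \<ge> x (1 + \<delta>)\<close>.\<close>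
  define r1 where "r1 = (1 / 2) powr (c / 2)"
  define r2 where "r2 = (1 - \<delta>) powr (c / 2)"
  define r3 where "r3 = (1 + \<delta>) powr (c / 2)"
  have r1: "0 < r1" "r1 < 1" and r2: "0 < r2" "r2 < 1" and r3: "1 < r3"
    using c \<delta> powr_less_mono2[of "c / 2" "1 / 2" 1] powr_less_mono2[of "c / 2" "1 - \<delta>" 1]
      powr_less_mono2[of "c / 2" 1 "1 + \<delta>"]
    by (auto simp: r1_def r2_def r3_def)
  have rate: "0 < chernoff_rate r" "chernoff_rate r < 1" if "r \<in> {r1, r2, r3}" for r
    using that r1 r2 r3 chernoff_rate_less_1 by auto
  \<comment> \<open>A bound for the distance of the second factor from its limit, valid for all \<open>u \<ge> X\<close> because \<open>D u > c / 2\<close> there.\<close>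
  define C where "C = B / (c / 2) + \<bar>K\<bar>"
  have "C \<ge> 0" using \<open>B \<ge> 0\<close> c by (simp add: C_def)

  \<comment> \<open>The error of the integral apart from \<open>\<eta>\<close>: in order, from \<open>(0, x / 2)\<close>, from both sides of the window,
    and from the mass of \<open>\<rho>\<close> missing below \<open>x / 2\<close>.\<close>
  define err where "err n = real n * chernoff_rate r1 ^ n * (B / 2) + C * chernoff_rate r2 ^ n + C * chernoff_rate r3 ^ n + \<bar>K\<bar> * chernoff_rate r1 ^ n"
    for n :: nat
  have "err \<longlonglongrightarrow> 0 * (B / 2) + C * 0 + C * 0 + \<bar>K\<bar> * 0"
    unfolding err_def using rate
    by (intro tendsto_intros powser_times_n_limit_0 LIMSEQ_power_zero) (auto simp: less_imp_le)
  then have "\<forall>\<^sub>F n in sequentially. err n < \<eta>"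
    using \<eta> by (intro order_tendstoD(2)) auto
  moreover have "\<forall>\<^sub>F n in sequentially. real n > \<Lambda> (2 * X)"
    by (rule filterlim_real_sequentially[unfolded filterlim_at_top_dense, rule_format])
  moreover have "\<forall>\<^sub>F n in sequentially. n > 0" by (rule eventually_gt_at_top)
  ultimately have large: "\<forall>\<^sub>F n in sequentially. n > 0 \<and> real n > \<Lambda> (2 * X) \<and> err n < \<eta>"
    by eventually_elim auto

  have main: "dist (\<integral>u. indicator {0<..} u * (real n * poisson n (\<Lambda> u) * (\<psi> (u / x) / x)) \<partial>lborel) K < \<epsilon>"
    if n: "n > 0" "real n > \<Lambda> (2 * X)" "err n < \<eta>" and x: "x > 0" "real n = \<Lambda> x" for n x
  proof -
    have "x > 2 * X"
      using n(2) x(2) monoD[OF mono, of x "2 * X"] by force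
    then have "X < x / 2" by simp
    obtain m where m: "n = Suc m" using n(1) by (cases n) auto
    define \<rho> where "\<rho> u = poisson m (\<Lambda> u) * (indicator {X..} u * \<Lambda>' u)" for u
    define U where "U a u = indicator {a..} u * \<rho> u" for a u
    have [measurable]: "\<rho> \<in> borel_measurable borel"
      unfolding \<rho>_def poisson_def using X
      by (intro borel_measurable_times borel_measurable_real_derivative) auto
    have \<rho>_nonneg: "\<rho> u \<ge> 0" for u
    proof (cases "u \<ge> X")
      case True
      then have "\<Lambda>' u = D u * \<Lambda> u / u" using X[OF True] by (simp add: D_def)
      then show ?thesis using X[OF True] c
        by (simp add: \<rho>_def poisson_nonneg nonneg)
    qed (simp add: \<rho>_def)
    have U_int: "has_bochner_integral lborel (U a) (1 - poisson_tail n (\<Lambda> a))" if "a \<ge> X" for a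
    proof (rule has_bochner_integral_nn_integral)
      have "(\<integral>\<^sup>+u. ennreal (\<rho> u) * indicator {a..} u \<partial>lborel) = ennreal (1 - poisson_tail n (\<Lambda> a))"
      proof (rule nn_integral_FTC_atLeast)
        fix u assume "a \<le> u"
        then show "((\<lambda>u. poisson_tail n (\<Lambda> u)) has_real_derivative \<rho> u) (at u)"
          using X[of u] that unfolding \<rho>_def m
          by (auto intro!: DERIV_chain2[OF poisson_tail_has_derivative])
      next
        show "((\<lambda>u. poisson_tail n (\<Lambda> u)) \<longlongrightarrow> 1) at_top"
          by (rule filterlim_compose[OF poisson_tail_tendsto_1 at_top])
      qed (use \<rho>_nonneg in auto)
      also have "(\<integral>\<^sup>+u. ennreal (\<rho> u) * indicator {a..} u \<partial>lborel) = (\<integral>\<^sup>+u. ennreal (U a u) \<partial>lborel)"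
        by (intro nn_integral_cong) (auto simp: U_def indicator_def)
      finally show "(\<integral>\<^sup>+u. ennreal (U a u) \<partial>lborel) = ennreal (1 - poisson_tail n (\<Lambda> a))" .
      show "U a \<in> borel_measurable lborel" unfolding U_def by measurable
      show "AE u in lborel. 0 \<le> U a u" using \<rho>_nonneg by (auto simp: U_def)
      show "0 \<le> 1 - poisson_tail n (\<Lambda> a)" using poisson_tail_bounds nonneg by simp
    qed

    define g where "g u = indicator {0<..} u * (real n * poisson n (\<Lambda> u) * (\<psi> (u / x) / x))" for u
    have [measurable]: "g \<in> borel_measurable borel"
      unfolding g_def poisson_def by measurable
    \<comment> \<open>The integrable majorant of the error: a constant below \<open>x / 2\<close>, and beyond it \<open>\<rho>\<close> times \<open>\<eta>\<close> in the window or \<open>C\<close> outside.\<close>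
    define R where "R u = indicator {0<..<x / 2} u * (real n * chernoff_rate r1 ^ n * (B / x)) + \<eta> * U (x / 2) u
        + C * (U (x / 2) u - U (x * (1 - \<delta>)) u) + C * U (x * (1 + \<delta>)) u" for u

    have low: "\<Lambda> (x * s) \<le> s powr (c / 2) * real n" if "1 / 2 \<le> s" "s \<le> 1" for s
    proof -
      have "x * (1 / 2) \<le> x * s" using that x by (intro mult_left_mono) auto
      with \<open>X < x / 2\<close> have "X \<le> x * s" by linarith
      then have "\<Lambda> (x * s) * (x / (x * s)) powr (c / 2) \<le> \<Lambda> x"
        using that x by (intro growth) (auto simp: mult_left_le)
      then show ?thesis using that x by (simp add: powr_divide field_simps)
    qed
    have high: "\<Lambda> (x * s) \<ge> s powr (c / 2) * real n" if "1 \<le> s" for s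
      using growth[of x "x * s"] that x \<open>X < x / 2\<close> \<open>X > 0\<close> by (simp add: mult.commute)

    have g_le: "\<bar>g u - K * U (x / 2) u\<bar> \<le> R u" for u
    proof -
      consider "u \<le> 0" | "0 < u" "u < x / 2" | "x / 2 \<le> u" by linarith
      then show ?thesis
      proof cases
        case 1
        moreover have "x * (1 - \<delta>) > 0" "x * (1 + \<delta>) > 0" using x \<delta> by auto
        ultimately show ?thesis using x by (simp add: g_def R_def U_def)
      next
        case 2
        have "\<Lambda> u \<le> r1 * real n"
          using low[of "1 / 2"] monoD[OF mono, of u "x / 2"] 2 by (simp add: r1_def)
        then have "poisson n (\<Lambda> u) \<le> chernoff_rate r1 ^ n"
          using r1 nonneg by (intro poisson_le_below) auto
        moreover have "\<bar>\<psi> (u / x)\<bar> \<le> B" using 2 x by (intro \<psi>_near) auto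
        ultimately have le: "real n * poisson n (\<Lambda> u) * (\<bar>\<psi> (u / x)\<bar> / x) \<le> real n * chernoff_rate r1 ^ n * (B / x)"
          using x rate[of r1] by (intro mult_mono divide_right_mono mult_left_mono) auto
        have "x / 2 \<le> x * (1 - \<delta>)" "x / 2 \<le> x * (1 + \<delta>)" using x \<delta> by (auto simp: field_simps)
        then have "u < x * (1 - \<delta>)" "u < x * (1 + \<delta>)" using 2 by linarith+
        then have "U (x / 2) u = 0" "U (x * (1 - \<delta>)) u = 0" "U (x * (1 + \<delta>)) u = 0"
          using 2 by (auto simp: U_def indicator_def)
        then show ?thesis
          using le 2 x poisson_nonneg[OF nonneg] by (simp add: g_def R_def abs_mult)
      next
        case 3
        then have u: "u \<ge> X" "u > 0" using \<open>X < x / 2\<close> \<open>X > 0\<close> by auto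
        note Xu = X[OF u(1)]
        define v where "v = u / x"
        have "v > 0" using u x by (simp add: v_def)
        have "D u > 0" using Xu c by linarith
        have g: "g u = \<rho> u * (v * \<psi> v / D u)"
        proof -
          have "\<Lambda>' u \<noteq> 0" using \<open>D u > 0\<close> by (auto simp: D_def)
          have "g u = \<Lambda> u * poisson m (\<Lambda> u) * (\<psi> v / x)"
            using u unfolding g_def m Suc_mult_poisson v_def by simp
          also have "\<dots> = \<rho> u * (v * \<psi> v / D u)"
            using u x Xu \<open>\<Lambda>' u \<noteq> 0\<close> by (simp add: \<rho>_def D_def v_def field_simps)
          finally show ?thesis .
        qed
        have eq: "\<bar>g u - K * U (x / 2) u\<bar> = \<rho> u * \<bar>v * \<psi> v / D u - K\<bar>"
        proof -
          have "g u - K * U (x / 2) u = \<rho> u * (v * \<psi> v / D u - K)"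
            using 3 by (simp add: g U_def algebra_simps)
          then show ?thesis using \<rho>_nonneg[of u] by (simp add: abs_mult)
        qed
        show ?thesis
        proof (cases "\<bar>v - 1\<bar> \<le> \<delta>")
          case True
          then have "\<bar>g u - K * U (x / 2) u\<bar> \<le> \<rho> u * \<eta>"
            unfolding eq using \<delta>(3) PQ Xu by (intro mult_left_mono less_imp_le \<rho>_nonneg) auto
          also have "\<dots> \<le> R u"
            using 3 \<rho>_nonneg[of u] \<open>C \<ge> 0\<close> by (auto simp: R_def U_def indicator_def)
          finally show ?thesis .
        next
          case False
          have "\<bar>v * \<psi> v / D u\<bar> \<le> B / (c / 2)"
            unfolding abs_divide using \<psi>_far[OF \<open>v > 0\<close>] Xu c by (intro frac_le) auto
          then have "\<bar>v * \<psi> v / D u - K\<bar> \<le> C"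
            unfolding C_def using abs_triangle_ineq4[of "v * \<psi> v / D u" K] by simp
          then have "\<bar>g u - K * U (x / 2) u\<bar> \<le> C * \<rho> u"
            unfolding eq using mult_left_mono[OF _ \<rho>_nonneg[of u]] by (simp only: mult.commute[of C])
          also have "\<dots> \<le> R u"
          proof -
            have "x * (1 + \<delta>) < u \<or> u < x * (1 - \<delta>)"
              using False x by (auto simp: v_def abs_if field_simps split: if_splits)
            then have "C * \<rho> u = C * (U (x / 2) u - U (x * (1 - \<delta>)) u) \<or>
                C * \<rho> u \<le> C * U (x * (1 + \<delta>)) u \<and> 0 \<le> C * (U (x / 2) u - U (x * (1 - \<delta>)) u)"
              using 3 \<open>C \<ge> 0\<close> \<rho>_nonneg[of u] by (auto simp: U_def indicator_def)
            moreover have "C * U (x * (1 + \<delta>)) u \<ge> 0" "\<eta> * U (x / 2) u \<ge> 0"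
              using \<rho>_nonneg[of u] \<open>C \<ge> 0\<close> \<eta> by (auto simp: U_def)
            ultimately show ?thesis
              using 3 by (auto simp: R_def)
          qed
          finally show ?thesis .
        qed
      qed
    qed
    have "x / 2 \<le> x * (1 - \<delta>)" "x / 2 \<le> x * (1 + \<delta>)" using x \<delta> by (auto simp: field_simps)
    then have bounds: "x / 2 \<ge> X" "x * (1 - \<delta>) \<ge> X" "x * (1 + \<delta>) \<ge> X"
      using \<open>X < x / 2\<close> by auto
    define T where "T s = poisson_tail n (\<Lambda> (x * s))" for s
    have T01: "0 \<le> T s" "T s \<le> 1" for s
      using poisson_tail_bounds nonneg by (auto simp: T_def)
    have U_int': "has_bochner_integral lborel (U (x * s)) (1 - T s)" if "x * s \<ge> X" for s
      using U_int[OF that] by (simp add: T_def)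
    have U_half: "has_bochner_integral lborel (U (x / 2)) (1 - T (1 / 2))"
      using U_int[OF bounds(1)] by (simp add: T_def)
    have R_int: "has_bochner_integral lborel R
        (measure lborel {0<..<x / 2} * (real n * chernoff_rate r1 ^ n * (B / x)) + \<eta> * (1 - T (1 / 2))
          + C * ((1 - T (1 / 2)) - (1 - T (1 - \<delta>))) + C * (1 - T (1 + \<delta>)))"
      unfolding R_def using bounds x
      by (intro has_bochner_integral_add has_bochner_integral_diff has_bochner_integral_mult_right
          has_bochner_integral_mult_left has_bochner_integral_real_indicator U_half U_int') auto
    have g_int: "integrable lborel g"
    proof (rule Bochner_Integration.integrable_bound)
      show "integrable lborel (\<lambda>u. R u + \<bar>K\<bar> * U (x / 2) u)"
        using R_int U_half by (auto simp: has_bochner_integral_iff)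
      have "norm (g u) \<le> norm (R u + \<bar>K\<bar> * U (x / 2) u)" for u
      proof -
        have "\<bar>K * U (x / 2) u\<bar> = \<bar>K\<bar> * U (x / 2) u"
          using \<rho>_nonneg[of u] by (simp add: abs_mult U_def)
        then show ?thesis using g_le[of u] by (simp add: abs_le_iff) linarith
      qed
      then show "AE u in lborel. norm (g u) \<le> norm (R u + \<bar>K\<bar> * U (x / 2) u)" by simp
    qed simp
    have "\<bar>(\<integral>u. g u \<partial>lborel) - K * (1 - T (1 / 2))\<bar> = \<bar>\<integral>u. g u - K * U (x / 2) u \<partial>lborel\<bar>"
      using g_int U_half by (simp add: has_bochner_integral_iff)
    also have "\<dots> \<le> (\<integral>u. R u \<partial>lborel)"
      using g_le g_int U_half R_int
      by (intro order_trans[OF integral_abs_bound] integral_mono) (auto simp: has_bochner_integral_iff)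
    also have "\<dots> = real n * chernoff_rate r1 ^ n * (B / 2) + \<eta> * (1 - T (1 / 2))
        + C * (T (1 - \<delta>) - T (1 / 2)) + C * (1 - T (1 + \<delta>))"
      using R_int x by (simp add: has_bochner_integral_iff)
    also have "\<dots> \<le> real n * chernoff_rate r1 ^ n * (B / 2) + \<eta> * 1 + C * chernoff_rate r2 ^ n + C * chernoff_rate r3 ^ n"
    proof (intro add_mono mult_left_mono)
      have "T (1 - \<delta>) \<le> chernoff_rate r2 ^ n"
        unfolding T_def using low[of "1 - \<delta>"] \<delta> r2 nonneg
        by (intro poisson_tail_le_below) (auto simp: r2_def)
      then show "T (1 - \<delta>) - T (1 / 2) \<le> chernoff_rate r2 ^ n" using T01(1)[of "1 / 2"] by simp
      show "1 - T (1 + \<delta>) \<le> chernoff_rate r3 ^ n"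
        unfolding T_def using high[of "1 + \<delta>"] \<delta> r3 nonneg
        by (intro one_minus_poisson_tail_le_above) (auto simp: r3_def)
    qed (use T01 \<eta> \<open>C \<ge> 0\<close> rate(1)[of r1] in auto)
    finally have *: "\<bar>(\<integral>u. g u \<partial>lborel) - K * (1 - T (1 / 2))\<bar>
        \<le> real n * chernoff_rate r1 ^ n * (B / 2) + \<eta> * 1 + C * chernoff_rate r2 ^ n + C * chernoff_rate r3 ^ n" .
    have "T (1 / 2) \<le> chernoff_rate r1 ^ n"
      unfolding T_def using low[of "1 / 2"] r1 nonneg
      by (intro poisson_tail_le_below) (auto simp: r1_def)
    then have "\<bar>K * T (1 / 2)\<bar> \<le> \<bar>K\<bar> * chernoff_rate r1 ^ n"
      using T01(1)[of "1 / 2"] by (auto simp: abs_mult intro: mult_left_mono)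
    then have "\<bar>(\<integral>u. g u \<partial>lborel) - K\<bar> \<le> err n + \<eta>"
      using * unfolding err_def by (simp add: right_diff_distrib abs_le_iff)
    then have "\<bar>(\<integral>u. g u \<partial>lborel) - K\<bar> < \<epsilon>"
      using n(3) \<epsilon> by (simp add: \<eta>_def)
    then show ?thesis by (simp add: dist_real_def g_def)
  qed
  show "\<forall>\<^sub>F p in inf (filtercomap fst at_top) (principal {(n, x). x > 0 \<and> real n = \<Lambda> x}).
      dist (case p of (n, x) \<Rightarrow>
        \<integral>u. indicator {0<..} u * (real n * poisson n (\<Lambda> u) * (\<psi> (u / x) / x)) \<partial>lborel) (\<psi> 1 / c) < \<epsilon>"
    unfolding eventually_inf_principal eventually_filtercomap
  proof (intro exI conjI allI impI)
    show "\<forall>\<^sub>F n in at_top. n > 0 \<and> real n > \<Lambda> (2 * X) \<and> err n < \<eta>" by (rule large)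
    fix p :: "nat \<times> real"
    assume "fst p > 0 \<and> real (fst p) > \<Lambda> (2 * X) \<and> err (fst p) < \<eta>"
      and "p \<in> {(n, x). x > 0 \<and> real n = \<Lambda> x}"
    then show "dist (case p of (n, x) \<Rightarrow>
        \<integral>u. indicator {0<..} u * (real n * poisson n (\<Lambda> u) * (\<psi> (u / x) / x)) \<partial>lborel) (\<psi> 1 / c) < \<epsilon>"
      using main[of "fst p" "snd p"] by (simp only: case_prod_beta mem_Collect_eq K_def)
  qed
qed

section \<open>The M-Wright series\<close>

text \<open>Logarithmic convexity of the Gamma function between \<open>x\<close> and \<open>x + 1\<close>.\<close>

lemma Gamma_add_le:
  fixes x s :: real
  assumes "x > 0" "0 < s" "s < 1"
  shows "Gamma (x + s) \<le> x powr s * Gamma x"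
proof -
  have "(ln \<circ> Gamma) ((1 - s) *\<^sub>R x + s *\<^sub>R (x + 1))
      \<le> (1 - s) * (ln \<circ> Gamma) x + s * (ln \<circ> Gamma) (x + 1)"
    using assms by (intro convex_onD[OF log_convex_Gamma_real]) auto
  moreover have "(1 - s) *\<^sub>R x + s *\<^sub>R (x + 1) = x + s"
    by (simp add: algebra_simps)
  moreover have "ln (Gamma (x + 1)) = ln x + ln (Gamma x)"
  proof -
    have "x \<notin> \<int>\<^sub>\<le>\<^sub>0" using assms nonpos_Ints_nonpos[of x] by force
    then have "Gamma (x + 1) = x * Gamma x" by (rule Gamma_plus1)
    moreover have "Gamma x > 0" using assms by (intro Gamma_real_pos)
    ultimately show ?thesis using assms by (simp add: ln_mult less_imp_neq[symmetric])
  qed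
  ultimately have "ln (Gamma (x + s)) \<le> ln (Gamma x) + s * ln x"
    by (simp add: algebra_simps)
  also have "\<dots> = ln (x powr s * Gamma x)"
    using assms Gamma_real_pos[of x] by (simp add: ln_mult ln_powr less_imp_neq[symmetric])
  finally show ?thesis
    using assms by (subst (asm) ln_le_cancel_iff) (auto intro!: Gamma_real_pos mult_pos_pos)
qed

text \<open>By the preceding lemma the ratio of consecutive terms is at most \<open>K (k + 1) powr (\<beta> - 1)\<close>, which tends to 0.
  The series dominates the M-Wright series and serves again to integrate that series termwise.\<close>

lemma summable_Gamma_mult_power_over_fact:
  fixes \<beta> K :: real
  assumes \<beta>: "0 < \<beta>" "\<beta> < 1" and K: "K \<ge> 0"
  shows "summable (\<lambda>k. Gamma (\<beta> * real (Suc k)) * K ^ k / fact k)"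
proof -
  have "((\<lambda>k. K * (real (Suc k)) powr (\<beta> - 1)) \<longlongrightarrow> K * 0) sequentially"
    using \<beta> by (intro tendsto_mult tendsto_const tendsto_neg_powr
        filterlim_compose[OF filterlim_real_sequentially filterlim_Suc]) auto
  then have "\<forall>\<^sub>F k in sequentially. K * (real (Suc k)) powr (\<beta> - 1) < 1 / 2"
    by (rule order_tendstoD) auto
  then obtain N where N: "\<And>k. k \<ge> N \<Longrightarrow> K * (real (Suc k)) powr (\<beta> - 1) < 1 / 2"
    by (auto simp: eventually_sequentially)
  show ?thesis
  proof (rule summable_ratio_test[where c = "1 / 2" and N = N])
    fix k assume k: "k \<ge> N"
    let ?x = "\<beta> * real (Suc k)"
    have pos: "Gamma ?x > 0" "Gamma (\<beta> * real (Suc (Suc k))) > 0"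
      using \<beta> by (auto intro!: Gamma_real_pos mult_pos_pos)
    have "Gamma (\<beta> * real (Suc (Suc k))) = Gamma (?x + \<beta>)"
      by (simp add: algebra_simps)
    also have "\<dots> \<le> ?x powr \<beta> * Gamma ?x"
      using \<beta> by (intro Gamma_add_le) auto
    also have "\<dots> \<le> real (Suc k) powr \<beta> * Gamma ?x"
      using \<beta> pos by (intro mult_right_mono powr_mono2) (auto simp: mult_left_le_one_le)
    finally have "Gamma (\<beta> * real (Suc (Suc k))) * K ^ Suc k / fact (Suc k)
        \<le> (real (Suc k) powr \<beta> * Gamma ?x) * K ^ Suc k / fact (Suc k)"
      using K by (intro divide_right_mono mult_right_mono) auto
    also have "\<dots> = (K * (real (Suc k)) powr (\<beta> - 1)) * (Gamma ?x * K ^ k / fact k)"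
      by (simp add: powr_diff field_simps del: of_nat_Suc)
    also have "\<dots> \<le> 1 / 2 * (Gamma ?x * K ^ k / fact k)"
      using N[OF k] pos K by (intro mult_right_mono) auto
    finally show "norm (Gamma (\<beta> * real (Suc (Suc k))) * K ^ Suc k / fact (Suc k))
        \<le> 1 / 2 * norm (Gamma ?x * K ^ k / fact k)"
      using pos K by (simp del: of_nat_Suc power_Suc fact_Suc)
  qed simp
qed

lemma summable_M_Wright:
  assumes \<beta>: "0 < \<beta>" "\<beta> < 1"
  shows "summable (\<lambda>k. (- z) ^ (Suc k - 1) / fact (Suc k - 1)
           * Gamma (\<beta> * real (Suc k)) * sin (pi * \<beta> * real (Suc k)))"
proof (rule summable_comparison_test)
  show "summable (\<lambda>k. Gamma (\<beta> * real (Suc k)) * \<bar>z\<bar> ^ k / fact k)"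
    using \<beta> by (intro summable_Gamma_mult_power_over_fact) auto
  have "norm ((- z) ^ (Suc k - 1) / fact (Suc k - 1) * Gamma (\<beta> * real (Suc k)) * sin (pi * \<beta> * real (Suc k)))
      \<le> Gamma (\<beta> * real (Suc k)) * \<bar>z\<bar> ^ k / fact k" for k
  proof -
    have pos: "Gamma (\<beta> * real (Suc k)) > 0" using \<beta> by (intro Gamma_real_pos) auto
    then have "norm ((- z) ^ (Suc k - 1) / fact (Suc k - 1) * Gamma (\<beta> * real (Suc k)) * sin (pi * \<beta> * real (Suc k)))
        = (Gamma (\<beta> * real (Suc k)) * \<bar>z\<bar> ^ k / fact k) * \<bar>sin (pi * \<beta> * real (Suc k))\<bar>"
      by (simp add: abs_mult power_abs del: of_nat_Suc)
    also have "\<dots> \<le> (Gamma (\<beta> * real (Suc k)) * \<bar>z\<bar> ^ k / fact k) * 1"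
      using pos by (intro mult_left_mono) auto
    finally show ?thesis by simp
  qed
  then show "\<exists>N. \<forall>k\<ge>N. norm ((- z) ^ (Suc k - 1) / fact (Suc k - 1)
      * Gamma (\<beta> * real (Suc k)) * sin (pi * \<beta> * real (Suc k)))
      \<le> Gamma (\<beta> * real (Suc k)) * \<bar>z\<bar> ^ k / fact k"
    by blast
qed

lemma isCont_M_Wright:
  assumes \<beta>: "0 < \<beta>" "\<beta> < 1"
  shows "isCont (M_Wright \<beta>) z"
proof -
  define a where "a k = (- 1) ^ k / fact k * Gamma (\<beta> * real (Suc k)) * sin (pi * \<beta> * real (Suc k))"
    for k
  have a: "(- z) ^ (Suc k - 1) / fact (Suc k - 1) * Gamma (\<beta> * real (Suc k)) * sin (pi * \<beta> * real (Suc k))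
      = a k * z ^ k" for k z
    using power_minus[of z k] by (simp add: a_def)
  have "isCont (\<lambda>z. 1 / pi * (\<Sum>k. a k * z ^ k)) z"
    using summable_M_Wright[OF \<beta>]
    by (intro continuous_intros isCont_powser_converges_everywhere) (simp only: a)
  also have "(\<lambda>z. 1 / pi * (\<Sum>k. a k * z ^ k)) = M_Wright \<beta>"
    by (intro ext) (simp only: M_Wright_def a)
  finally show ?thesis .
qed

section \<open>Gamma integrals along a rotated ray\<close>

lemma has_bochner_integral_Gamma:
  assumes "s > (0::real)"
  shows "has_bochner_integral lborel (\<lambda>r. indicator {0<..} r * (r powr (s - 1) / exp r)) (Gamma s)"
proof -
  have "(\<lambda>r. indicator {0<..} r * (r powr (s - 1) / exp r))
      = (\<lambda>r::real. indicator {0..} r * r powr (s - 1) / exp r)"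
    by (auto simp: fun_eq_iff indicator_def)
  then show ?thesis
    using Gamma_conv_nn_integral_real[OF assms] Gamma_real_pos[OF assms]
    by (simp only:) (intro has_bochner_integral_nn_integral, auto)
qed

text \<open>For complex \<open>q\<close> close to 1, expand \<open>exp (- q r) = exp (- r) exp ((1 - q) r)\<close> in powers of \<open>1 - q\<close> and integrate
  termwise. The integrals are Gamma values, and the resulting series is the binomial series of
  \<open>(1 + (q - 1)) powr (- w)\<close>. This replaces a rotation of the contour.\<close>

lemma Gamma_integral_complex_rate:
  fixes q :: complex and w :: real
  assumes w: "w > 0" and q: "norm (q - 1) < 1"
  shows "has_bochner_integral lborel
           (\<lambda>r. indicator {0<..} r *\<^sub>R (of_real (r powr (w - 1)) * exp (- q * of_real r)))
           (of_real (Gamma w) * q powr (- of_real w))"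
proof -
  define F where "F m r =
    indicator {0<..} r *\<^sub>R (of_real (r powr (w + real m - 1) / exp r) * ((1 - q) ^ m / fact m))" for m r
  have F_eq: "F m r = of_real (indicator {0<..} r * (r powr (w + real m - 1) / exp r))
                        * ((1 - q) ^ m / fact m)" for m r
    by (simp add: F_def scaleR_conv_of_real)
  have norm_F: "norm (F m r) = (indicator {0<..} r * (r powr (w + real m - 1) / exp r))
                        * (norm (1 - q) ^ m / fact m)" for m r
    by (simp add: F_def norm_mult norm_divide norm_power)
  have Gamma_eq: "Gamma (w + real m) / fact m = Gamma w * ((- 1) ^ m * ((- w) gchoose m))" for m
  proof -
    have "w \<notin> \<int>\<^sub>\<le>\<^sub>0" using w nonpos_Ints_nonpos[of w] by force
    then have "pochhammer w m = Gamma (w + real m) / Gamma w" by (rule pochhammer_Gamma)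
    moreover have "Gamma w > 0" using w by (rule Gamma_real_pos)
    ultimately show ?thesis
      by (simp add: gbinomial_pochhammer field_simps flip: power_add mult_2)
  qed
  have hb: "has_bochner_integral lborel (F m)
      (of_real (Gamma (w + real m)) * ((1 - q) ^ m / fact m))" for m
    unfolding F_eq
    using w by (intro has_bochner_integral_mult_left has_bochner_integral_of_real has_bochner_integral_Gamma) auto
  have hbn: "has_bochner_integral lborel (\<lambda>r. norm (F m r))
      (Gamma (w + real m) * (norm (1 - q) ^ m / fact m))" for m
    unfolding norm_F
    using w by (intro has_bochner_integral_mult_left has_bochner_integral_Gamma) auto
  have F_norm_summable: "summable (\<lambda>m. \<integral>r. norm (F m r) \<partial>lborel)"
  proof -
    have "summable (\<lambda>m. Gamma w * (((- w) gchoose m) * (- norm (1 - q)) ^ m))"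
      using gen_binomial_real[of "- norm (1 - q)" "- w"] q
      by (intro summable_mult sums_summable) (auto simp: norm_minus_commute)
    also have "(\<lambda>m. Gamma w * (((- w) gchoose m) * (- norm (1 - q)) ^ m))
        = (\<lambda>m. \<integral>r. norm (F m r) \<partial>lborel)"
    proof
      fix m
      have "(\<integral>r. norm (F m r) \<partial>lborel) = Gamma (w + real m) / fact m * norm (1 - q) ^ m"
        using hbn[of m] by (simp add: has_bochner_integral_iff)
      then show "Gamma w * (((- w) gchoose m) * (- norm (1 - q)) ^ m) = (\<integral>r. norm (F m r) \<partial>lborel)"
        by (simp add: Gamma_eq power_minus[of "norm (1 - q)"])
    qed
    finally show ?thesis .
  qed
  have F_sums: "(\<lambda>m. F m r) sums
      (indicator {0<..} r *\<^sub>R (of_real (r powr (w - 1)) * exp (- q * of_real r)))"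
    and F_abs: "summable (\<lambda>m. norm (F m r))" for r
  proof -
    have F_exp: "F m r = indicator {0<..} r *\<^sub>R (of_real (r powr (w - 1) / exp r)
                    * (((1 - q) * of_real r) ^ m /\<^sub>R fact m))" for m
    proof (cases "r > 0")
      case True
      then have "r powr (w + real m - 1) = r powr (w - 1) * r ^ m"
        by (simp add: algebra_simps flip: powr_realpow powr_add)
      then show ?thesis
        by (simp add: F_def power_mult_distrib scaleR_conv_of_real divide_inverse)
    qed (simp add: F_def)
    have "(\<lambda>m. F m r) sums (indicator {0<..} r *\<^sub>R (of_real (r powr (w - 1) / exp r)
                    * exp ((1 - q) * of_real r)))"
      unfolding F_exp by (intro sums_scaleR_right sums_mult exp_converges)
    also have "of_real (r powr (w - 1) / exp r) * exp ((1 - q) * of_real r)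
        = of_real (r powr (w - 1)) * exp (- q * of_real r)"
      by (simp add: ring_distribs exp_diff exp_minus exp_of_real field_simps)
    finally show "(\<lambda>m. F m r) sums
      (indicator {0<..} r *\<^sub>R (of_real (r powr (w - 1)) * exp (- q * of_real r)))" .
    show "summable (\<lambda>m. norm (F m r))"
      unfolding F_exp norm_scaleR norm_mult
      by (intro summable_mult summable_norm_exp[unfolded norm_scaleR norm_mult])
  qed
  have int: "integrable lborel (F m)" for m using hb[of m] by (simp add: has_bochner_integral_iff)
  have F_suminf: "(\<lambda>r. \<Sum>m. F m r)
      = (\<lambda>r. indicator {0<..} r *\<^sub>R (of_real (r powr (w - 1)) * exp (- q * of_real r)))"
    using F_sums by (simp add: fun_eq_iff sums_iff)
  have "integrable lborel (\<lambda>r. \<Sum>m. F m r)"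
    using F_abs by (intro integrable_suminf int F_norm_summable) auto
  moreover have "(\<lambda>m. integral\<^sup>L lborel (F m)) sums (\<integral>r. (\<Sum>m. F m r) \<partial>lborel)"
    using F_abs by (intro sums_integral int F_norm_summable) auto
  moreover have "(\<lambda>m. integral\<^sup>L lborel (F m)) sums (of_real (Gamma w) * q powr (- of_real w))"
  proof -
    have "integral\<^sup>L lborel (F m) = of_real (Gamma w) * (((- of_real w) gchoose m) * (q - 1) ^ m)" for m
    proof -
      have "integral\<^sup>L lborel (F m) = of_real (Gamma (w + real m) / fact m) * (1 - q) ^ m"
        using hb[of m] by (simp add: has_bochner_integral_iff)
      also have "\<dots> = of_real (Gamma w) * ((of_real (- w) gchoose m) * ((- 1) ^ m * (1 - q) ^ m))"
        unfolding Gamma_eq by (simp add: gbinomial_prod_rev)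
      also have "(- 1) ^ m * (1 - q) ^ m = (q - 1) ^ m"
        by (simp flip: power_mult_distrib)
      finally show ?thesis by simp
    qed
    moreover have "(\<lambda>m. of_real (Gamma w) * (((- of_real w) gchoose m) * (q - 1) ^ m))
        sums (of_real (Gamma w) * (1 + (q - 1)) powr (- of_real w))"
      using q by (intro sums_mult gen_binomial_complex)
    ultimately show ?thesis by simp
  qed
  ultimately show ?thesis
    unfolding F_suminf using sums_unique2 by (auto simp: has_bochner_integral_iff)
qed


text \<open>The rate \<open>cos \<alpha> * cis (- \<alpha>)\<close> lies on the ray at angle \<open>- \<alpha>\<close> and, for \<open>0 < \<alpha> < pi / 2\<close>, within distance
  \<open>sin \<alpha> < 1\<close> of 1, so the binomial expansion applies to it. Its real part is \<open>\<kappa>\<^sup>2\<close>, the rate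
  in the absolute integral.\<close>

lemma
  fixes \<beta> w :: real
  assumes \<beta>: "0 < \<beta>" "\<beta> < 1" and w: "w > 0"
  defines "\<alpha> \<equiv> pi * \<beta> / (1 + \<beta>)"
  defines "\<kappa> \<equiv> cos \<alpha>"
  shows rotated_Gamma_integral: "has_bochner_integral lborel
           (\<lambda>r. indicator {0<..} r *\<^sub>R (of_real (r powr (w - 1)) * exp (- (of_real \<kappa> * cis (- \<alpha>)) * of_real r)))
           (of_real (Gamma w * \<kappa> powr (- w)) * cis (\<alpha> * w))"
    and rotated_Gamma_integral_norm: "has_bochner_integral lborel
           (\<lambda>r. indicator {0<..} r * (r powr (w - 1) * exp (- (\<kappa>\<^sup>2 * r))))
           (Gamma w * \<kappa> powr (- (2 * w)))"
proof -
  have \<alpha>: "0 < \<alpha>" "\<alpha> < pi / 2"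
    using \<beta> by (auto simp: \<alpha>_def field_simps)
  then have \<kappa>: "0 < \<kappa>" "\<kappa> < 1"
    using cos_gt_zero_pi[of \<alpha>] cos_monotone_0_pi[of 0 \<alpha>] by (auto simp: \<kappa>_def)
  define q where "q = of_real \<kappa> * cis (- \<alpha>)"
  have "(norm (q - 1))\<^sup>2 = (\<kappa> * cos \<alpha> - 1)\<^sup>2 + (\<kappa> * sin \<alpha>)\<^sup>2"
    by (simp add: q_def cmod_power2)
  also have "\<dots> = (\<kappa> * \<kappa> - 1)\<^sup>2 + \<kappa>\<^sup>2 * (1 - \<kappa>\<^sup>2)"
    by (simp add: \<kappa>_def power_mult_distrib sin_squared_eq)
  also have "\<dots> = 1 - \<kappa>\<^sup>2"
    by (simp add: power2_eq_square algebra_simps)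
  also have "\<dots> < 1\<^sup>2" using \<kappa> by simp
  finally have q: "norm (q - 1) < 1"
    by (rule power_less_imp_less_base) simp
  have Ln_q: "Ln q = of_real (ln \<kappa>) - \<i> * of_real \<alpha>"
  proof -
    have "q = exp (of_real (ln \<kappa>) - \<i> * of_real \<alpha>)"
      using \<kappa> by (simp add: q_def exp_diff cis_conv_exp exp_minus divide_inverse exp_of_real)
    then show ?thesis
      using \<alpha> by (simp add: Ln_exp)
  qed
  have "q \<noteq> 0" using \<kappa> by (simp add: q_def)
  then have "q powr (- of_real w) = of_real (exp (- w * ln \<kappa>)) * cis (\<alpha> * w)"
    unfolding powr_def Ln_q by (simp add: cis_conv_exp algebra_simps flip: exp_of_real exp_add)
  also have "exp (- w * ln \<kappa>) = \<kappa> powr (- w)"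
    using \<kappa> by (simp add: powr_def)
  finally show "has_bochner_integral lborel
           (\<lambda>r. indicator {0<..} r *\<^sub>R (of_real (r powr (w - 1)) * exp (- (of_real \<kappa> * cis (- \<alpha>)) * of_real r)))
           (of_real (Gamma w * \<kappa> powr (- w)) * cis (\<alpha> * w))"
    using Gamma_integral_complex_rate[OF w q] by (simp add: q_def mult.assoc)
  have "norm (of_real (\<kappa>\<^sup>2) - 1 :: complex) = \<bar>\<kappa>\<^sup>2 - 1\<bar>"
    by (metis norm_of_real of_real_1 of_real_diff)
  moreover have "\<kappa>\<^sup>2 < 1" "\<kappa>\<^sup>2 > 0" using \<kappa> by (auto simp: power_less_one_iff abs_square_less_1)
  ultimately have "norm (of_real (\<kappa>\<^sup>2) - 1 :: complex) < 1" by simp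
  from has_bochner_integral_Re[OF Gamma_integral_complex_rate[OF w this]]
  have "has_bochner_integral lborel
      (\<lambda>r. Re (indicator {0<..} r *\<^sub>R (of_real (r powr (w - 1)) * exp (- of_real (\<kappa>\<^sup>2) * of_real r))))
      (Re (of_real (Gamma w) * of_real (\<kappa>\<^sup>2) powr - of_real w))" .
  moreover have "Re (indicator {0<..} r *\<^sub>R (of_real (r powr (w - 1)) * exp (- of_real (\<kappa>\<^sup>2) * of_real r)))
      = indicator {0<..} r * (r powr (w - 1) * exp (- (\<kappa>\<^sup>2 * r)))" for r
  proof -
    have "exp (- of_real (\<kappa>\<^sup>2) * of_real r) = (of_real (exp (- (\<kappa>\<^sup>2 * r))) :: complex)"
      by (simp flip: exp_of_real)
    then show ?thesis by simp
  qed
  moreover have "Re (of_real (Gamma w) * of_real (\<kappa>\<^sup>2) powr - of_real w) = Gamma w * \<kappa> powr (- (2 * w))"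
  proof -
    have "of_real (\<kappa>\<^sup>2) powr - of_real w = (of_real ((\<kappa>\<^sup>2) powr (- w)) :: complex)"
      using powr_of_real[of "\<kappa>\<^sup>2" "- w"] by simp
    moreover have "(\<kappa>\<^sup>2) powr (- w) = \<kappa> powr (- (2 * w))"
      using \<kappa> by (simp add: powr_powr flip: powr_numeral)
    ultimately show ?thesis by simp
  qed
  ultimately show "has_bochner_integral lborel
           (\<lambda>r. indicator {0<..} r * (r powr (w - 1) * exp (- (\<kappa>\<^sup>2 * r))))
           (Gamma w * \<kappa> powr (- (2 * w)))" by (simp only:)
qed

text \<open>The antiderivative is \<open>- exp (- a r\<^sup>\<beta>)\<close>; for \<open>\<beta> < 1\<close> the integrand is singular at 0, so the interval is open there.\<close>

lemma integral_stretched_exp: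
  fixes a \<beta> :: real
  assumes "a > 0" "\<beta> > 0"
  shows "has_bochner_integral lborel
           (\<lambda>r. indicator {0<..} r * (a * \<beta> * r powr (\<beta> - 1) * exp (- (a * r powr \<beta>)))) 1"
proof -
  let ?f = "\<lambda>r. a * \<beta> * r powr (\<beta> - 1) * exp (- (a * r powr \<beta>))"
  let ?F = "\<lambda>r. - exp (- (a * r powr \<beta>))"
  have at0: "(?F \<longlongrightarrow> - 1) (at_right 0)"
  proof -
    have "(?F \<longlongrightarrow> - exp (- (a * 0))) (at_right 0)"
      using assms
      by (intro tendsto_intros tendsto_zero_powrI[where b = \<beta>])
         (auto intro: eventually_at_rightI[of 0 1])
    then show ?thesis by simp
  qed
  have at_inf: "(?F \<longlongrightarrow> - 0) at_top"
  proof (intro tendsto_minus)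
    have "filterlim (\<lambda>r. a * r powr \<beta>) at_top at_top"
    proof (rule filterlim_cong[THEN iffD1, OF refl refl])
      show "\<forall>\<^sub>F r in at_top. a * exp (\<beta> * ln r) = a * r powr \<beta>"
        using eventually_gt_at_top[of 0] by eventually_elim (simp add: powr_def)
      show "filterlim (\<lambda>r. a * exp (\<beta> * ln r)) at_top at_top"
        using assms
        by (intro filterlim_tendsto_pos_mult_at_top[OF tendsto_const] filterlim_compose[OF exp_at_top] ln_at_top)
    qed
    then show "((\<lambda>r. exp (- (a * r powr \<beta>))) \<longlongrightarrow> 0) at_top"
      by (intro filterlim_compose[OF exp_at_bot] filterlim_uminus_at_top[THEN iffD1])
  qed
  have "set_integrable lborel (einterval 0 \<infinity>) ?f" "(LBINT r=0..\<infinity>. ?f r) = - 0 - (- 1)"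
  proof -
    have D: "DERIV ?F x :> ?f x" if "0 < ereal x" for x
      using that assms by (auto intro!: derivative_eq_intros)
    have C: "isCont ?f x" if "0 < ereal x" for x
      using that by (intro continuous_intros) auto
    have A: "((?F \<circ> real_of_ereal) \<longlongrightarrow> - 1) (at_right 0)"
      using at0 unfolding zero_ereal_def ereal_tendsto_simps .
    have B: "((?F \<circ> real_of_ereal) \<longlongrightarrow> - 0) (at_left \<infinity>)"
      using at_inf by (simp add: ereal_tendsto_simps)
    show "set_integrable lborel (einterval 0 \<infinity>) ?f" "(LBINT r=0..\<infinity>. ?f r) = - 0 - (- 1)"
      using assms by (intro interval_integral_FTC_nonneg[OF _ D C _ A B]; simp)+
  qed
  then show ?thesis
    by (simp add: has_bochner_integral_iff interval_lebesgue_integral_def set_integrable_def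
        set_lebesgue_integral_def zero_ereal_def)
qed

section \<open>Decay and scaling of the M-Wright function\<close>

text \<open>Let \<open>\<alpha> = pi \<beta> / (1 + \<beta>)\<close>. The angle \<open>pi \<beta> j\<close> in the M-Wright series splits as \<open>\<alpha> j + \<alpha> \<beta> j\<close>. The second part is
  absorbed by the Gamma integral along the ray at angle \<open>- \<alpha>\<close>, and the first one turns the sum over
  \<open>j\<close> into the exponential of \<open>- z (\<kappa> r)\<^sup>\<beta> cis \<alpha>\<close>. Since \<open>0 < \<alpha> < pi / 2\<close>, both the
  Gamma kernel and this exponential decay. With \<open>\<alpha> = 0\<close>, the usual Gamma integral, the exponential would
  be that of \<open>- z r\<^sup>\<beta> cis (pi \<beta>)\<close>, which grows for \<open>\<beta> > 1 / 2\<close>. Bounding the Gamma kernel by 1 leaves a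
  stretched exponential in \<open>r\<close>, whose integral is of order \<open>1 / z\<close>.\<close>

theorem abs_mult_M_Wright_le:
  fixes \<beta> z :: real
  assumes \<beta>: "0 < \<beta>" "\<beta> < 1" and z: "z \<ge> 0"
  shows "\<bar>z * M_Wright \<beta> z\<bar> \<le> 1 / (pi * \<beta> * cos (pi * \<beta> / (1 + \<beta>)))"
proof (cases "z = 0")
  case True
  have "0 < pi * \<beta> / (1 + \<beta>)" "pi * \<beta> / (1 + \<beta>) < pi / 2"
    using \<beta> by (auto simp: field_simps)
  then have "cos (pi * \<beta> / (1 + \<beta>)) > 0" by (intro cos_gt_zero) auto
  then show ?thesis using True \<beta> by simp
next
  case False
  with z have z: "z > 0" by simp
  define \<alpha> where "\<alpha> = pi * \<beta> / (1 + \<beta>)"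
  define \<kappa> where "\<kappa> = cos \<alpha>"
  have \<alpha>: "0 < \<alpha>" "\<alpha> < pi / 2"
    using \<beta> by (auto simp: \<alpha>_def field_simps)
  then have \<kappa>: "0 < \<kappa>" using cos_gt_zero_pi[of \<alpha>] by (auto simp: \<kappa>_def)
  define q where "q = of_real \<kappa> * cis (- \<alpha>)"
  have Re_q: "Re q = \<kappa>\<^sup>2" by (simp add: q_def \<kappa>_def power2_eq_square)
  \<comment> \<open>\<open>F k\<close> is the integrand whose integral is the \<open>k\<close>-th term of the series with \<open>sin\<close> replaced by \<open>cis\<close>; \<open>S\<close> is the sum of all \<open>F k\<close>.\<close>
  define A where "A k = of_real ((- z) ^ k / fact k * \<kappa> powr (\<beta> * real (Suc k))) * cis (\<alpha> * real (Suc k))" for k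
  define F where "F k r = A k * (indicator {0<..} r *\<^sub>R
      (of_real (r powr (\<beta> * real (Suc k) - 1)) * exp (- q * of_real r)))" for k r
  define S where "S r = indicator {0<..} r *\<^sub>R (of_real (\<kappa> powr \<beta> * r powr (\<beta> - 1)) * cis \<alpha>
      * exp (- q * of_real r) * exp (- of_real (z * (\<kappa> * r) powr \<beta>) * cis \<alpha>))" for r
  have norm_A: "norm (A k) = z ^ k / fact k * \<kappa> powr (\<beta> * real (Suc k))" for k
    using z by (simp add: A_def norm_mult norm_power norm_divide del: of_nat_Suc)

  have int_F: "has_bochner_integral lborel (F k)
      (of_real ((- z) ^ k / fact k * Gamma (\<beta> * real (Suc k))) * cis (pi * \<beta> * real (Suc k)))" for k
  proof -
    let ?w = "\<beta> * real (Suc k)"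
    have "has_bochner_integral lborel (F k)
        (A k * (of_real (Gamma ?w * \<kappa> powr (- ?w)) * cis (\<alpha> * ?w)))"
      unfolding F_def q_def \<kappa>_def \<alpha>_def
      using \<beta> by (intro has_bochner_integral_mult_right rotated_Gamma_integral) auto
    also have "A k * (of_real (Gamma ?w * \<kappa> powr (- ?w)) * cis (\<alpha> * ?w))
        = of_real ((- z) ^ k / fact k * Gamma ?w * (\<kappa> powr ?w * \<kappa> powr (- ?w)))
          * (cis (\<alpha> * real (Suc k)) * cis (\<alpha> * ?w))"
      unfolding A_def by (simp only: of_real_mult mult_ac)
    also have "\<kappa> powr ?w * \<kappa> powr (- ?w) = 1"
      using \<kappa> by (simp add: powr_minus)
    also have "cis (\<alpha> * real (Suc k)) * cis (\<alpha> * ?w) = cis (pi * \<beta> * real (Suc k))"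
    proof -
      have "\<alpha> * real (Suc k) + \<alpha> * ?w = \<alpha> * (1 + \<beta>) * real (Suc k)"
        by (simp only: ring_distribs mult_ac mult_1)
      also have "\<alpha> * (1 + \<beta>) = pi * \<beta>" using \<beta> by (simp add: \<alpha>_def)
      finally show ?thesis by (simp only: cis_mult)
    qed
    finally show ?thesis by simp
  qed
  have norm_F: "(\<integral>r. norm (F k r) \<partial>lborel)
      = \<kappa> powr (- \<beta>) * (Gamma (\<beta> * real (Suc k)) * (z * \<kappa> powr (- \<beta>)) ^ k / fact k)" for k
  proof -
    let ?w = "\<beta> * real (Suc k)"
    have "norm (F k r) = norm (A k) * (indicator {0<..} r * (r powr (?w - 1) * exp (- (\<kappa>\<^sup>2 * r))))" for r
      by (simp add: F_def norm_mult norm_exp Re_q del: of_nat_Suc)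
    moreover have "has_bochner_integral lborel
        (\<lambda>r. norm (A k) * (indicator {0<..} r * (r powr (?w - 1) * exp (- (\<kappa>\<^sup>2 * r)))))
        (norm (A k) * (Gamma ?w * \<kappa> powr (- (2 * ?w))))"
      unfolding \<kappa>_def \<alpha>_def
      using \<beta> by (intro has_bochner_integral_mult_right rotated_Gamma_integral_norm) auto
    ultimately have "(\<integral>r. norm (F k r) \<partial>lborel) = norm (A k) * (Gamma ?w * \<kappa> powr (- (2 * ?w)))"
      by (simp only: has_bochner_integral_iff)
    also have "\<dots> = z ^ k / fact k * Gamma ?w * (\<kappa> powr ?w * \<kappa> powr (- (2 * ?w)))"
      unfolding norm_A by (simp only: mult_ac)
    also have "\<kappa> powr ?w * \<kappa> powr (- (2 * ?w)) = (\<kappa> powr (- \<beta>)) powr (real (Suc k))"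
      by (simp add: powr_powr flip: powr_add del: of_nat_Suc)
    also have "\<dots> = (\<kappa> powr (- \<beta>)) ^ Suc k"
      using \<kappa> by (subst powr_realpow) auto
    finally show ?thesis by (simp add: power_mult_distrib)
  qed
  have F_sums: "(\<lambda>k. F k r) sums S r" and F_abs: "summable (\<lambda>k. norm (F k r))" for r
  proof -
    have F_exp: "F k r = indicator {0<..} r *\<^sub>R (of_real (\<kappa> powr \<beta> * r powr (\<beta> - 1)) * cis \<alpha>
      * exp (- q * of_real r) * ((- of_real (z * (\<kappa> * r) powr \<beta>) * cis \<alpha>) ^ k /\<^sub>R fact k))" for k
    proof (cases "r > 0")
      case True
      have 1: "\<kappa> powr (\<beta> * real (Suc k)) = \<kappa> powr \<beta> * (\<kappa> powr \<beta>) ^ k"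
        using \<kappa> by (simp add: powr_powr algebra_simps flip: powr_realpow powr_add)
      have 2: "r powr (\<beta> * real (Suc k) - 1) = r powr (\<beta> - 1) * (r powr \<beta>) ^ k"
        using True by (simp add: powr_powr algebra_simps flip: powr_realpow powr_add)
      have 3: "cis (\<alpha> * real (Suc k)) = cis \<alpha> * cis \<alpha> ^ k"
        using Complex.DeMoivre[of \<alpha> "Suc k"] by (simp only: power_Suc mult.commute[of \<alpha>])
      have 4: "(- of_real (z * (\<kappa> * r) powr \<beta>) * cis \<alpha>) ^ k
          = of_real ((- z) ^ k * (\<kappa> powr \<beta>) ^ k * (r powr \<beta>) ^ k) * cis \<alpha> ^ k"
        using \<kappa> True by (simp add: powr_mult mult.assoc flip: power_mult_distrib)
      show ?thesis
        using True unfolding F_def A_def 1 2 3 4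
        by (simp add: scaleR_conv_of_real divide_inverse)
    qed (simp add: F_def)
    show "(\<lambda>k. F k r) sums S r"
      unfolding F_exp S_def by (intro sums_scaleR_right sums_mult exp_converges)
    show "summable (\<lambda>k. norm (F k r))"
      unfolding F_exp norm_scaleR norm_mult
      by (intro summable_mult summable_norm_exp[unfolded norm_scaleR])
  qed
  have int: "integrable lborel (F k)" for k using int_F[of k] by (simp add: has_bochner_integral_iff)
  have norms: "summable (\<lambda>k. \<integral>r. norm (F k r) \<partial>lborel)"
    unfolding norm_F using \<beta> z by (intro summable_mult summable_Gamma_mult_power_over_fact) auto
  have S_eq: "(\<lambda>r. \<Sum>k. F k r) = S" using F_sums by (auto simp: sums_iff)
  have int_S: "integrable lborel S"
    using integrable_suminf[OF int _ norms] F_abs by (simp add: S_eq)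
  have "(\<lambda>k. integral\<^sup>L lborel (F k)) sums integral\<^sup>L lborel S"
    using sums_integral[OF int _ norms] F_abs by (simp add: S_eq)
  then have "(\<lambda>k. Im (integral\<^sup>L lborel (F k))) sums Im (integral\<^sup>L lborel S)"
    by (rule sums_Im)
  also have "(\<lambda>k. Im (integral\<^sup>L lborel (F k)))
      = (\<lambda>k. (- z) ^ (Suc k - 1) / fact (Suc k - 1) * Gamma (\<beta> * real (Suc k)) * sin (pi * \<beta> * real (Suc k)))"
    using int_F by (auto simp: has_bochner_integral_iff simp del: of_nat_Suc of_real_mult of_real_divide)
  finally have M: "M_Wright \<beta> z = 1 / pi * Im (integral\<^sup>L lborel S)"
    by (simp add: M_Wright_def sums_iff)

  let ?a = "z * \<kappa> * \<kappa> powr \<beta>"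
  let ?b = "\<lambda>r. indicator {0<..} r * (?a * \<beta> * r powr (\<beta> - 1) * exp (- (?a * r powr \<beta>)))"
  have b: "has_bochner_integral lborel ?b 1"
    using z \<kappa> \<beta> by (intro integral_stretched_exp) auto
  have le: "norm (S r) \<le> 1 / (z * \<kappa> * \<beta>) * ?b r" for r
  proof (cases "r > 0")
    case True
    have "norm (S r) = \<kappa> powr \<beta> * r powr (\<beta> - 1) * exp (- (\<kappa>\<^sup>2 * r)) * exp (- (z * (\<kappa> * r) powr \<beta> * \<kappa>))"
      using True by (simp add: S_def norm_mult norm_exp Re_q \<kappa>_def)
    also have "\<dots> \<le> \<kappa> powr \<beta> * r powr (\<beta> - 1) * 1 * exp (- (z * (\<kappa> * r) powr \<beta> * \<kappa>))"
      using True by (intro mult_right_mono mult_left_mono) auto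
    also have "\<dots> = 1 / (z * \<kappa> * \<beta>) * ?b r"
      using True z \<kappa> \<beta> by (simp add: powr_mult field_simps)
    finally show ?thesis .
  qed (simp add: S_def)
  have "norm (integral\<^sup>L lborel S) \<le> (\<integral>r. 1 / (z * \<kappa> * \<beta>) * ?b r \<partial>lborel)"
    using b le by (intro order_trans[OF integral_norm_bound] integral_mono integrable_norm int_S
        integrable_mult_right) (auto simp: has_bochner_integral_iff)
  also have "\<dots> = 1 / (z * \<kappa> * \<beta>)"
    using has_bochner_integral_mult_right[OF b, of "1 / (z * \<kappa> * \<beta>)"]
    by (simp only: has_bochner_integral_iff mult_1_right)
  finally have "\<bar>Im (integral\<^sup>L lborel S)\<bar> \<le> 1 / (z * \<kappa> * \<beta>)"
    using abs_Im_le_cmod order_trans by blast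
  then have "z / pi * \<bar>Im (integral\<^sup>L lborel S)\<bar> \<le> z / pi * (1 / (z * \<kappa> * \<beta>))"
    using z by (intro mult_left_mono) auto
  then have "\<bar>z * M_Wright \<beta> z\<bar> \<le> z / pi * (1 / (z * \<kappa> * \<beta>))"
    using z by (simp add: M abs_mult)
  then show ?thesis
    using z by (simp add: \<kappa>_def \<alpha>_def field_simps)
qed

text \<open>The two series agree term by term up to a common factor, by \<open>Gamma (\<beta> j + 1) = \<beta> j Gamma (\<beta> j)\<close>. The density
  is thus a scaling family with scale \<open>t\<^sup>\<beta>\<close>.\<close>

lemma inverse_stable_density_eq_M_Wright:
  assumes "0 < \<beta>" "\<beta> < 1" "t > 0" "u > 0"
  shows "inverse_stable_density \<beta> t u = t powr (- \<beta>) * M_Wright \<beta> (u * t powr (- \<beta>))"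
proof -
  define v where "v = u * t powr (- \<beta>)"
  have v: "v > 0" using assms by (simp add: v_def)
  define C where "C = t / (\<beta> * u powr (1 + 1 / \<beta>))"
  define T where "T k = (- 1) ^ (Suc k + 1) * (Gamma (\<beta> * real (Suc k) + 1) / Gamma (real (Suc k) + 1))
      * (1 / (t / u powr (1 / \<beta>)) powr (\<beta> * real (Suc k) + 1)) * sin (\<beta> * pi * real (Suc k))" for k
  define m where "m k = (- v) ^ (Suc k - 1) / fact (Suc k - 1)
      * Gamma (\<beta> * real (Suc k)) * sin (pi * \<beta> * real (Suc k))" for k
  have "C \<noteq> 0" using assms by (simp add: C_def)
  have T: "T k = t powr (- \<beta>) / C * m k" for k
  proof -
    let ?j = "real (Suc k)"
    have 1: "Gamma (\<beta> * ?j + 1) = \<beta> * ?j * Gamma (\<beta> * ?j)"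
    proof (rule Gamma_plus1)
      have "\<beta> * ?j > 0" using assms by simp
      then show "\<beta> * ?j \<notin> \<int>\<^sub>\<le>\<^sub>0" using nonpos_Ints_nonpos[of "\<beta> * ?j"] by force
    qed
    have 2: "Gamma (?j + 1) = ?j * fact k"
      using Gamma_fact[of "Suc k", where 'a = real] by (simp add: add.commute)
    have 3: "1 / (t / u powr (1 / \<beta>)) powr (\<beta> * ?j + 1) = u powr (1 / \<beta>) / t * (v * v ^ k)"
    proof -
      have a1: "(t / u powr (1 / \<beta>)) powr (\<beta> * ?j + 1)
          = t * t powr (\<beta> * ?j) / (u powr ?j * u powr (1 / \<beta>))"
        using assms by (simp add: powr_divide powr_powr powr_add algebra_simps)
      have a2: "v * v ^ k = v powr ?j" using v by (simp add: powr_realpow del: of_nat_Suc)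
      have a3: "v powr ?j = u powr ?j / t powr (\<beta> * ?j)"
        using assms unfolding v_def by (subst powr_mult) (simp_all add: powr_powr powr_minus_divide powr_divide del: of_nat_Suc)
      show ?thesis unfolding a1 a2 a3 using assms by (simp add: divide_simps)
    qed
    have 4: "t powr (- \<beta>) / C = \<beta> * u powr (1 / \<beta>) / t * v"
    proof -
      have "u powr (1 + 1 / \<beta>) = u * u powr (1 / \<beta>)" using assms by (subst powr_add) simp
      then show ?thesis using assms unfolding C_def v_def by (simp add: divide_simps)
    qed
    show ?thesis
      unfolding T_def m_def 1 2 3 4 using power_minus[of v k]
      by (simp add: mult_ac del: of_nat_Suc)
  qed
  have "inverse_stable_density \<beta> t u = C * (1 / pi * (\<Sum>k. T k))"
    by (simp add: inverse_stable_density_def stable_density_def T_def C_def)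
  also have "(\<Sum>k. T k) = t powr (- \<beta>) / C * (\<Sum>k. m k)"
    unfolding T using summable_M_Wright[of \<beta> v] assms
    by (intro suminf_mult) (simp add: m_def del: of_nat_Suc)
  finally show ?thesis
    using \<open>C \<noteq> 0\<close> by (simp add: M_Wright_def m_def v_def)
qed

section \<open>The marginal probabilities\<close>

lemma tendsto_of_bigo_ln:
  fixes f :: "real \<Rightarrow> real"
  assumes "(\<lambda>x. f x - c / x) \<in> O[at_top](\<lambda>x. 1 / (x * ln x))"
  shows "((\<lambda>x. x * f x) \<longlongrightarrow> c) at_top"
proof -
  obtain K where K: "\<forall>\<^sub>F x in at_top. norm (f x - c / x) \<le> K * norm (1 / (x * ln x))"
    using assms by (elim landau_o.bigE)
  have "((\<lambda>x. x * (f x - c / x)) \<longlongrightarrow> 0) at_top"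
  proof (rule Lim_null_comparison)
    show "\<forall>\<^sub>F x in at_top. norm (x * (f x - c / x)) \<le> K * inverse (ln x)"
      using K eventually_gt_at_top[of 1]
    proof eventually_elim
      fix x :: real assume x: "1 < x" and le: "norm (f x - c / x) \<le> K * norm (1 / (x * ln x))"
      have "norm (x * (f x - c / x)) = x * norm (f x - c / x)" using x by (simp add: abs_mult)
      also have "\<dots> \<le> x * (K * norm (1 / (x * ln x)))" using x le by (intro mult_left_mono) auto
      also have "\<dots> = K * inverse (ln x)" using x by (simp add: field_simps)
      finally show "norm (x * (f x - c / x)) \<le> K * inverse (ln x)" .
    qed
    show "((\<lambda>x::real. K * inverse (ln x)) \<longlongrightarrow> 0) at_top"
      by (intro tendsto_mult_right_zero tendsto_inverse_0_at_top ln_at_top)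
  qed
  then have "((\<lambda>x. x * (f x - c / x) + c) \<longlongrightarrow> 0 + c) at_top" by (intro tendsto_intros)
  moreover have "\<forall>\<^sub>F x in at_top. x * (f x - c / x) + c = x * f x"
    using eventually_gt_at_top[of 0] by eventually_elim (simp add: field_simps)
  ultimately show ?thesis unfolding add_0_left by (rule Lim_transform_eventually)
qed

text \<open>With \<open>x = z t\<^sup>\<beta>\<close> the scaling form of the density is a kernel \<open>\<psi> (u / x) / x\<close> for \<open>\<psi> v = z M (z v)\<close>. The Borel
  function \<open>L\<close> stands for \<open>\<Lambda>\<close>, whose values on the negative axis are arbitrary.\<close>

lemma fnpp_prob_eq_poisson_integral:
  fixes \<Lambda> :: "real \<Rightarrow> real"
  assumes \<beta>: "0 < \<beta>" "\<beta> < 1" and t: "t > 0" and z: "z > 0"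
    and [measurable]: "L \<in> borel_measurable borel" and L: "\<And>u. u > 0 \<Longrightarrow> L u = \<Lambda> u"
  shows "real n * fnpp_prob \<Lambda> \<beta> n t = (\<integral>u. indicator {0<..} u *
      (real n * poisson n (L u) * (z * M_Wright \<beta> (z * (u / (z * t powr \<beta>))) / (z * t powr \<beta>))) \<partial>lborel)"
    (is "_ = (\<integral>u. ?f u \<partial>lborel)")
proof -
  have "continuous_on UNIV (M_Wright \<beta>)"
    using isCont_M_Wright[OF \<beta>] by (simp add: continuous_at_imp_continuous_on)
  then have [measurable]: "M_Wright \<beta> \<in> borel_measurable borel"
    by (rule borel_measurable_continuous_onI)
  have "real n * fnpp_prob \<Lambda> \<beta> n t = (\<integral>u. ?f u \<partial>lebesgue)"
  proof -
    have "real n * (indicator {0<..} u *\<^sub>R (exp (- \<Lambda> u) * \<Lambda> u ^ n / fact n * inverse_stable_density \<beta> t u))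
        = ?f u" for u
    proof (cases "u > 0")
      case True
      have "z * (u / (z * t powr \<beta>)) = u * t powr (- \<beta>)"
        using z by (simp add: powr_minus_divide)
      then show ?thesis
        using True t z inverse_stable_density_eq_M_Wright[OF \<beta> t True]
        by (simp add: poisson_def L powr_minus_divide)
    qed simp
    then show ?thesis
      unfolding fnpp_prob_def set_lebesgue_integral_def integral_mult_right_zero[symmetric] by (simp only:)
  qed
  also have "\<dots> = (\<integral>u. ?f u \<partial>lborel)"
    unfolding poisson_def by (intro integral_completion) measurable
  finally show ?thesis .
qed

theorem theorem1:
  fixes lam \<Lambda> :: "real \<Rightarrow> real" and c \<beta> z\<^sub>0 :: real
  assumes lam_nonneg: "\<And>u. u \<ge> 0 \<Longrightarrow> lam u \<ge> 0"
    and lam_integrable: "\<And>t. t \<ge> 0 \<Longrightarrow> set_integrable lebesgue {0..t} lam"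
    and Lambda: "\<And>t. t \<ge> 0 \<Longrightarrow> \<Lambda> t = (LINT u:{0..t}|lebesgue. lam u)"
    and Lambda_at_top: "filterlim \<Lambda> at_top at_top"
    and c_pos: "c > 0"
    and Lambda_diff: "\<forall>\<^sub>F x in at_top. \<Lambda> field_differentiable at x"
    and Lambda_deriv: "(\<lambda>x. deriv \<Lambda> x / \<Lambda> x - c / x) \<in> O[at_top](\<lambda>x. 1 / (x * ln x))"
    and beta: "0 < \<beta>" "\<beta> < 1"
    and z0_pos: "z\<^sub>0 > 0"
  shows "((\<lambda>(n, t). real n * fnpp_prob \<Lambda> \<beta> n t) \<longlongrightarrow> z\<^sub>0 / c * M_Wright \<beta> z\<^sub>0)
           (along_level \<Lambda> \<beta> z\<^sub>0)"
proof -
  \<comment> \<open>Constant extension to the left makes \<open>\<Lambda>\<close> monotone on the whole line.\<close>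
  define L where "L u = \<Lambda> (max 0 u)" for u
  define \<psi> where "\<psi> v = z\<^sub>0 * M_Wright \<beta> (z\<^sub>0 * v)" for v
  have L_eq: "L u = \<Lambda> u" if "u > 0" for u using that by (simp add: L_def)
  have L_eventually: "\<forall>\<^sub>F u in at_top. L u = \<Lambda> u"
    using eventually_gt_at_top[of 0] by eventually_elim (rule L_eq)
  have mono: "mono L"
  proof (rule monoI)
    fix x y :: real assume "x \<le> y"
    define a b where "a = max 0 x" and "b = max 0 y"
    have ab: "0 \<le> a" "a \<le> b" using \<open>x \<le> y\<close> by (auto simp: a_def b_def)
    have "(LINT u:{0..a}|lebesgue. lam u) \<le> (LINT u:{0..b}|lebesgue. lam u)"
      unfolding set_lebesgue_integral_def
    proof (rule integral_mono)
      show "integrable lebesgue (\<lambda>u. indicator {0..a} u *\<^sub>R lam u)"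
        "integrable lebesgue (\<lambda>u. indicator {0..b} u *\<^sub>R lam u)"
        using lam_integrable[of a] lam_integrable[of b] ab by (auto simp: set_integrable_def)
      show "indicator {0..a} u *\<^sub>R lam u \<le> indicator {0..b} u *\<^sub>R lam u" for u
        using ab lam_nonneg[of u] by (cases "u \<le> a"; cases "0 \<le> u") (auto simp: indicator_def)
    qed
    then show "L x \<le> L y" using ab by (simp add: L_def Lambda a_def b_def)
  qed
  have nonneg: "L u \<ge> 0" for u
    unfolding L_def using lam_nonneg
    by (subst Lambda) (auto simp: set_lebesgue_integral_def indicator_def intro!: Bochner_Integration.integral_nonneg)
  have at_top: "filterlim L at_top at_top"
    using Lambda_at_top L_eventually by (subst filterlim_cong[OF refl refl]) auto
  have deriv: "\<forall>\<^sub>F u in at_top. (L has_real_derivative deriv \<Lambda> u) (at u)"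
    using Lambda_diff eventually_gt_at_top[of 0]
  proof eventually_elim
    fix u :: real assume u: "0 < u" and "\<Lambda> field_differentiable at u"
    then have "(\<Lambda> has_real_derivative deriv \<Lambda> u) (at u)"
      by (simp add: field_differentiable_derivI)
    then show "(L has_real_derivative deriv \<Lambda> u) (at u)"
      by (rule has_field_derivative_transform_within_open[where S = "{0<..}"]) (use u L_eq in auto)
  qed
  have ratio: "((\<lambda>u. u * deriv \<Lambda> u / L u) \<longlongrightarrow> c) at_top"
  proof (rule Lim_transform_eventually)
    show "((\<lambda>u. u * (deriv \<Lambda> u / \<Lambda> u)) \<longlongrightarrow> c) at_top"
      by (rule tendsto_of_bigo_ln[OF Lambda_deriv])
    show "\<forall>\<^sub>F u in at_top. u * (deriv \<Lambda> u / \<Lambda> u) = u * deriv \<Lambda> u / L u"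
      using L_eventually by eventually_elim simp
  qed
  have \<psi>_cont: "isCont \<psi> v" for v
    unfolding \<psi>_def by (intro continuous_intros isCont_o2[OF _ isCont_M_Wright[OF beta]])
  then have \<psi>_cont_on: "continuous_on S \<psi>" for S
    by (simp add: continuous_at_imp_continuous_on)
  obtain B1 where B1: "\<And>v. 0 \<le> v \<Longrightarrow> v \<le> 1 \<Longrightarrow> \<bar>\<psi> v\<bar> \<le> B1"
    using compact_imp_bounded[OF compact_continuous_image[OF \<psi>_cont_on compact_Icc[of 0 1]]]
    unfolding bounded_iff by fastforce
  define B2 where "B2 = 1 / (pi * \<beta> * cos (pi * \<beta> / (1 + \<beta>)))"
  have B2: "\<bar>v * \<psi> v\<bar> \<le> B2" if "v > 0" for v
    using abs_mult_M_Wright_le[OF beta, of "z\<^sub>0 * v"] that z0_pos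
    by (simp add: \<psi>_def B2_def mult_ac)
  have core: "((\<lambda>(n, x). \<integral>u. indicator {0<..} u * (real n * poisson n (L u) * (\<psi> (u / x) / x)) \<partial>lborel)
           \<longlongrightarrow> \<psi> 1 / c) (inf (filtercomap fst at_top) (principal {(n, x). x > 0 \<and> real n = L x}))"
    using B1 B2 borel_measurable_continuous_onI[OF \<psi>_cont_on]
    by (intro poisson_kernel_concentration[where B = "max B1 B2" and \<Lambda>' = "deriv \<Lambda>"]
        mono nonneg at_top deriv ratio c_pos \<psi>_cont) (auto simp: le_max_iff_disj)
  have level: "filterlim (\<lambda>(n, t). (n, z\<^sub>0 * t powr \<beta>))
      (inf (filtercomap fst at_top) (principal {(n, x). x > 0 \<and> real n = L x})) (along_level \<Lambda> \<beta> z\<^sub>0)"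
  proof -
    have "filterlim (\<lambda>(n, t). (n, z\<^sub>0 * t powr \<beta>)) (filtercomap fst at_top) (along_level \<Lambda> \<beta> z\<^sub>0)"
    proof -
      have "filterlim fst at_top (along_level \<Lambda> \<beta> z\<^sub>0)"
        unfolding along_level_def by (rule filterlim_mono[OF filterlim_filtercomap order_refl inf_le1])
      then show ?thesis
        by (simp add: filterlim_filtercomap_iff o_def case_prod_beta)
    qed
    moreover have "\<forall>\<^sub>F p in along_level \<Lambda> \<beta> z\<^sub>0.
        (case p of (n, t) \<Rightarrow> (n, z\<^sub>0 * t powr \<beta>)) \<in> {(n, x). x > 0 \<and> real n = L x}"
      unfolding along_level_def eventually_inf_principal
      using z0_pos by (intro always_eventually) (auto simp: L_eq)
    ultimately show ?thesis by (simp add: filterlim_inf filterlim_principal)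
  qed
  have "((\<lambda>(n, t). real n * fnpp_prob \<Lambda> \<beta> n t) \<longlongrightarrow> \<psi> 1 / c) (along_level \<Lambda> \<beta> z\<^sub>0)"
  proof (rule Lim_transform_eventually[OF filterlim_compose[OF core level]])
    show "\<forall>\<^sub>F p in along_level \<Lambda> \<beta> z\<^sub>0.
        (case (case p of (n, t) \<Rightarrow> (n, z\<^sub>0 * t powr \<beta>)) of (n, x) \<Rightarrow>
          \<integral>u. indicator {0<..} u * (real n * poisson n (L u) * (\<psi> (u / x) / x)) \<partial>lborel)
        = (case p of (n, t) \<Rightarrow> real n * fnpp_prob \<Lambda> \<beta> n t)"
      unfolding along_level_def eventually_inf_principal
    proof (intro always_eventually allI impI; clarify)
      fix n :: nat and t :: real assume "t > 0"
      from fnpp_prob_eq_poisson_integral[OF beta this z0_pos borel_measurable_mono[OF mono] L_eq]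
      show "(\<integral>u. indicator {0<..} u * (real n * poisson n (L u)
              * (\<psi> (u / (z\<^sub>0 * t powr \<beta>)) / (z\<^sub>0 * t powr \<beta>))) \<partial>lborel)
          = real n * fnpp_prob \<Lambda> \<beta> n t"
        unfolding \<psi>_def by (rule sym)
    qed
  qed
  also have "\<psi> 1 / c = z\<^sub>0 / c * M_Wright \<beta> z\<^sub>0" by (simp add: \<psi>_def)
  finally show ?thesis .
qed

end
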